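(* Let $\Omega\subset\mathbb{R}^2$ be a bounded domain with $C^1$ boundary, and let $(u,p)$, with $u:\Omega\times(0,\infty)\to\mathbb{R}^2$ and $p:\Omega\times(0,\infty)\to\mathbb{R}$, be a smooth solution of the two-dimensional incompressible Navier--Stokes equations $$u_t+(u\cdot\nabla)u-\Delta u+\nabla p=0,\qquad \mathrm{div}\,u=0\qquad\text{in }\Omega\times(0,\infty),$$ with $u(\cdot,t)\in H^1_0(\Omega)$ for every $t>0$ (no-slip boundary condition $u=0$ on $\partial\Omega$). Then, at any fixed time $t>0$, the pressure cannot satisfy $\Delta p(\cdot,t)\le0$ in $\Omega$ unless $\Delta p(\cdot,t)\equiv0$ in $\Omega$. Moreover, for any $t>0$ there exists $z\in\Omega$ such that $\Delta p(z,t)=0$.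
   Context: The operators $\nabla$, $\Delta$ and $\mathrm{div}$ act in the space variables. "Smooth" means that $u$ and $p$ are $C^\infty$ in $\Omega\times(0,\infty)$. $H^1_0(\Omega)$ is the closure of $C_c^\infty(\Omega)$ in the $L^2$-based Sobolev space $H^1(\Omega)$ (applied componentwise to vector fields). *)

theory Defs
  imports "HOL-Analysis.Analysis"
begin

section \<open>Smooth functions\<close>

text \<open>
  These notions are used on open sets \<open>S\<close> only, where derivatives do not depend on the
  values of a function outside \<open>S\<close>.
\<close>

primrec Ck_on ::
  "nat \<Rightarrow> ('a::real_normed_vector \<Rightarrow> 'b::real_normed_vector) \<Rightarrow> 'a set \<Rightarrow> bool" where
  "Ck_on 0 f S \<longleftrightarrow> continuous_on S f"
| "Ck_on (Suc k) f S \<longleftrightarrow>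
     (\<forall>x\<in>S. f differentiable (at x)) \<and>
     (\<forall>v. Ck_on k (\<lambda>x. frechet_derivative f (at x) v) S)"

definition smooth_on ::
  "('a::real_normed_vector \<Rightarrow> 'b::real_normed_vector) \<Rightarrow> 'a set \<Rightarrow> bool" where
  "smooth_on f S \<longleftrightarrow> (\<forall>k. Ck_on k f S)"


section \<open>Differential operators in the space variables\<close>

definition partial_deriv ::
  "'n::finite \<Rightarrow> (real^'n \<Rightarrow> 'b::real_normed_vector) \<Rightarrow> real^'n \<Rightarrow> 'b" where
  "partial_deriv i f x = frechet_derivative f (at x) (axis i 1)"

definition gradient :: "(real^'n::finite \<Rightarrow> real) \<Rightarrow> real^'n \<Rightarrow> real^'n" where
  "gradient f x = (\<chi> i. partial_deriv i f x)"

definition divergence :: "(real^'n::finite \<Rightarrow> real^'n) \<Rightarrow> real^'n \<Rightarrow> real" where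
  "divergence F x = (\<Sum>i\<in>UNIV. partial_deriv i (\<lambda>y. F y $ i) x)"

definition laplacian ::
  "(real^'n::finite \<Rightarrow> 'b::real_normed_vector) \<Rightarrow> real^'n \<Rightarrow> 'b" where
  "laplacian f x = (\<Sum>i\<in>UNIV. partial_deriv i (partial_deriv i f) x)"

text \<open>\<open>advection F G\<close> is the vector field \<open>(F \<cdot> \<nabla>) G\<close>.\<close>

definition advection ::
  "(real^'n::finite \<Rightarrow> real^'n) \<Rightarrow> (real^'n \<Rightarrow> real^'n) \<Rightarrow> real^'n \<Rightarrow> real^'n" where
  "advection F G x = (\<Sum>j\<in>UNIV. (F x $ j) *\<^sub>R partial_deriv j G x)"


section \<open>Planar domains with continuously differentiable boundary\<close>

definition is_domain :: "'a::topological_space set \<Rightarrow> bool" where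
  "is_domain \<Omega> \<longleftrightarrow> open \<Omega> \<and> connected \<Omega> \<and> \<Omega> \<noteq> {}"

text \<open>
  Near each boundary point, after an orthogonal change of coordinates \<open>R\<close>, the set is the part
  of a ball lying strictly above the graph of a \<open>C\<^sup>1\<close> function of one variable.
\<close>

definition C1_boundary :: "(real^2) set \<Rightarrow> bool" where
  "C1_boundary \<Omega> \<longleftrightarrow>
     (\<forall>x0 \<in> frontier \<Omega>. \<exists>r>0. \<exists>(R :: real^2 \<Rightarrow> real^2) (\<gamma> :: real \<Rightarrow> real).
        orthogonal_transformation R \<and> \<gamma> C1_differentiable_on UNIV \<and>
        \<Omega> \<inter> ball x0 r = {x \<in> ball x0 r. R x $ 2 > \<gamma> (R x $ 1)})"


section \<open>The Sobolev spaces \<open>H\<^sup>1\<close> and \<open>H\<^sup>1\<^sub>0\<close>\<close>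

text \<open>
  Elements of \<open>L\<^sup>2\<close> and \<open>H\<^sup>1\<close> are represented by functions on the whole space; all notions below
  except \<open>test_functions\<close> depend on the restriction to \<open>\<Omega>\<close> up to null sets only.
  Test functions are extended by zero outside \<open>\<Omega>\<close>.
\<close>

definition test_functions :: "(real^'n::finite) set \<Rightarrow> (real^'n \<Rightarrow> real) set" where
  "test_functions \<Omega> =
     {\<phi>. smooth_on \<phi> UNIV \<and> compact (closure {x. \<phi> x \<noteq> 0}) \<and> closure {x. \<phi> x \<noteq> 0} \<subseteq> \<Omega>}"

definition L2 :: "(real^'n::finite) set \<Rightarrow> (real^'n \<Rightarrow> 'b::euclidean_space) set" where
  "L2 \<Omega> = {f. f \<in> borel_measurable (lebesgue_on \<Omega>) \<and>
              integrable (lebesgue_on \<Omega>) (\<lambda>x. (norm (f x))\<^sup>2)}"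

definition locally_integrable_on ::
  "(real^'n::finite \<Rightarrow> 'b::euclidean_space) \<Rightarrow> (real^'n) set \<Rightarrow> bool" where
  "locally_integrable_on f \<Omega> \<longleftrightarrow>
     (\<forall>K. compact K \<and> K \<subseteq> \<Omega> \<longrightarrow> f absolutely_integrable_on K)"

definition is_weak_gradient ::
  "(real^'n::finite) set \<Rightarrow> (real^'n \<Rightarrow> real) \<Rightarrow> (real^'n \<Rightarrow> real^'n) \<Rightarrow> bool" where
  "is_weak_gradient \<Omega> f g \<longleftrightarrow>
     locally_integrable_on f \<Omega> \<and> locally_integrable_on g \<Omega> \<and>
     (\<forall>\<phi> \<in> test_functions \<Omega>. \<forall>i.
        (LINT x|lebesgue_on \<Omega>. f x * partial_deriv i \<phi> x) =
        - (LINT x|lebesgue_on \<Omega>. g x $ i * \<phi> x))"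

text \<open>
  A weak gradient on an open set is unique up to a null set, so the choice below does not
  affect \<open>H1_norm\<close>.
\<close>

definition weak_gradient ::
  "(real^'n::finite) set \<Rightarrow> (real^'n \<Rightarrow> real) \<Rightarrow> real^'n \<Rightarrow> real^'n" where
  "weak_gradient \<Omega> f = (SOME g. is_weak_gradient \<Omega> f g)"

definition H1 :: "(real^'n::finite) set \<Rightarrow> (real^'n \<Rightarrow> real) set" where
  "H1 \<Omega> = {f \<in> L2 \<Omega>. \<exists>g \<in> L2 \<Omega>. is_weak_gradient \<Omega> f g}"

definition H1_norm :: "(real^'n::finite) set \<Rightarrow> (real^'n \<Rightarrow> real) \<Rightarrow> real" where
  "H1_norm \<Omega> f =
     sqrt ((LINT x|lebesgue_on \<Omega>. (f x)\<^sup>2) +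
           (LINT x|lebesgue_on \<Omega>. (norm (weak_gradient \<Omega> f x))\<^sup>2))"

definition H10 :: "(real^'n::finite) set \<Rightarrow> (real^'n \<Rightarrow> real) set" where
  "H10 \<Omega> = {f \<in> H1 \<Omega>. \<forall>e>0. \<exists>\<phi> \<in> test_functions \<Omega>. H1_norm \<Omega> (\<lambda>x. f x - \<phi> x) < e}"


section \<open>The incompressible Navier--Stokes equations\<close>

definition smooth_navier_stokes_solution ::
  "(real^2) set \<Rightarrow> (real^2 \<Rightarrow> real \<Rightarrow> real^2) \<Rightarrow> (real^2 \<Rightarrow> real \<Rightarrow> real) \<Rightarrow> bool" where
  "smooth_navier_stokes_solution \<Omega> u p \<longleftrightarrow>
     smooth_on (\<lambda>(x, t). u x t) (\<Omega> \<times> {0<..}) \<and>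
     smooth_on (\<lambda>(x, t). p x t) (\<Omega> \<times> {0<..}) \<and>
     (\<forall>x\<in>\<Omega>. \<forall>t>0.
        vector_derivative (\<lambda>s. u x s) (at t)
          + advection (\<lambda>y. u y t) (\<lambda>y. u y t) x
          - laplacian (\<lambda>y. u y t) x
          + gradient (\<lambda>y. p y t) x = 0 \<and>
        divergence (\<lambda>y. u y t) x = 0)"

end

theory Submission
  imports Defs
begin

text \<open>
  Taking the divergence of the momentum equation gives \<open>\<Delta> p = 2 det (\<nabla> u)\<close> in the plane. For \<open>u\<close>
  in \<open>H\<^sup>1\<^sub>0\<close> the integral of \<open>det (\<nabla> u)\<close> over \<open>\<Omega>\<close> vanishes, because \<open>det (\<nabla> u\<^sub>1, \<nabla> \<phi>)\<close> is a divergence for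
  every test function \<open>\<phi>\<close>, and test functions approximate \<open>u\<^sub>2\<close> in \<open>H\<^sup>1\<close>. A continuous function with
  zero mean that does not change sign is zero, and on a connected set a continuous function
  without zeros does not change sign.
\<close>

section \<open>Calculus of \<open>C\<^sup>k\<close> functions\<close>

text \<open>The velocity is smooth only inside \<Omega>, so its gradient may be unbounded near the
  boundary and no boundary term can be written down. Every integration by parts is therefore done
  against a test function, and the limit uses only the L^2 norm of the gradient. That norm enters
  through \<open>H1_norm\<close>, whose \<open>weak_gradient\<close> is picked by
  \<open>SOME\<close>: before any estimate, the chosen function has to be identified almost
  everywhere with the classical \<open>gradient\<close>. This calls for the fundamental lemma of the
  calculus of variations, and hence for a supply of explicit test functions. The formula for
  \<Delta> p is special to the plane: the divergence of the momentum equation leaves minus the trace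
  of the square of \<nabla> u, and for a 2 by 2 matrix of trace zero this is twice the determinant.
  The differentiation takes place in space-time, where time is one more direction and a single
  symmetry theorem for second derivatives serves all terms.\<close>

lemma frechet_derivative_eqI:
  "(f has_derivative f') (at x) \<Longrightarrow> frechet_derivative f (at x) v = f' v"
  using frechet_derivative_at by metis

text \<open>The derivative is taken \<open>at x\<close> in the whole space, so it is determined only
  by values near \<open>x\<close>; openness of \<open>S\<close> supplies the neighbourhood, and
  equal derivatives feed the induction.\<close>

lemma Ck_on_cong:
  assumes "open S" "\<And>x. x \<in> S \<Longrightarrow> f x = g x" "Ck_on k f S"
  shows "Ck_on k g S"
  using assms(2,3)
proof (induction k arbitrary: f g)
  case 0
  then show ?case by (metis Ck_on.simps(1) continuous_on_cong)
next
  case (Suc k)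
  have der: "(g has_derivative frechet_derivative f (at x)) (at x)" if "x \<in> S" for x
  proof (rule has_derivative_transform_within_open)
    show "(f has_derivative frechet_derivative f (at x)) (at x)"
      using Suc.prems(2) that frechet_derivative_works by auto
  qed (use assms(1) that Suc.prems(1) in auto)
  have "Ck_on k (\<lambda>x. frechet_derivative g (at x) v) S" for v
  proof (rule Suc.IH)
    show "Ck_on k (\<lambda>x. frechet_derivative f (at x) v) S"
      using Suc.prems(2) by simp
    show "frechet_derivative f (at x) v = frechet_derivative g (at x) v" if "x \<in> S" for x
      using der[OF that] frechet_derivative_eqI by metis
  qed
  then show ?case
    using der by (auto simp: differentiable_def)
qed

lemma Ck_on_subset: "Ck_on k f S \<Longrightarrow> T \<subseteq> S \<Longrightarrow> Ck_on k f T"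
proof (induction k arbitrary: f)
  case 0
  then show ?case using continuous_on_subset by auto
next
  case (Suc k)
  then show ?case by (auto simp: subset_iff)
qed

lemma Ck_on_Suc_D: "Ck_on (Suc k) f S \<Longrightarrow> Ck_on k f S"
proof (induction k arbitrary: f)
  case 0
  then show ?case
    by (auto simp: continuous_at_imp_continuous_on differentiable_imp_continuous_within)
next
  case (Suc k)
  have "Ck_on k (\<lambda>x. frechet_derivative f (at x) v) S" for v
    using Suc.IH Suc.prems Ck_on.simps(2) by blast
  moreover have "\<forall>x\<in>S. f differentiable at x"
    using Suc.prems Ck_on.simps(2) by blast
  ultimately show ?case
    using Ck_on.simps(2) by blast
qed

lemma Ck_on_mono: "Ck_on m f S \<Longrightarrow> k \<le> m \<Longrightarrow> Ck_on k f S"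
  by (induction m) (use Ck_on_Suc_D le_Suc_eq in blast)+

lemma Ck_on_imp_continuous_on: "Ck_on k f S \<Longrightarrow> continuous_on S f"
  using Ck_on_mono[of k f S 0] by simp

lemma Ck_on_Suc_has_derivative:
  "Ck_on (Suc k) f S \<Longrightarrow> x \<in> S \<Longrightarrow> (f has_derivative frechet_derivative f (at x)) (at x)"
  using frechet_derivative_works by auto

text \<open>Lets the inductions below work with an explicit derivative from the usual rules in place
  of \<open>frechet_derivative\<close>.\<close>

lemma Ck_on_SucI:
  assumes "open S" "\<And>x. x \<in> S \<Longrightarrow> (f has_derivative f' x) (at x)"
    and "\<And>v. Ck_on k (\<lambda>x. f' x v) S"
  shows "Ck_on (Suc k) f S"
proof -
  have "Ck_on k (\<lambda>x. frechet_derivative f (at x) v) S" for v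
    by (rule Ck_on_cong[OF assms(1) _ assms(3)]) (simp add: frechet_derivative_eqI[OF assms(2)])
  then show ?thesis
    using assms(2) by (auto simp: differentiable_def)
qed

lemma Ck_on_const: "Ck_on k (\<lambda>x. c) S"
  by (induction k arbitrary: c) (auto simp: frechet_derivative_const)

lemma Ck_on_add:
  assumes "open S" "Ck_on k f S" "Ck_on k g S"
  shows "Ck_on k (\<lambda>x. f x + g x) S"
  using assms(2,3)
proof (induction k arbitrary: f g)
  case 0
  then show ?case by (simp add: continuous_on_add)
next
  case (Suc k)
  show ?case
  proof (rule Ck_on_SucI[OF assms(1)])
    show "((\<lambda>x. f x + g x) has_derivative
        (\<lambda>v. frechet_derivative f (at x) v + frechet_derivative g (at x) v)) (at x)"
      if "x \<in> S" for x
      by (rule has_derivative_add[OF Suc.prems[THEN Ck_on_Suc_has_derivative, OF that]])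
    show "Ck_on k (\<lambda>x. frechet_derivative f (at x) v + frechet_derivative g (at x) v) S" for v
      by (rule Suc.IH) (use Suc.prems Ck_on.simps(2) in blast)+
  qed
qed

lemma Ck_on_bounded_linear:
  assumes "open S" "bounded_linear L" "Ck_on k f S"
  shows "Ck_on k (\<lambda>x. L (f x)) S"
  using assms(3)
proof (induction k arbitrary: f)
  case 0
  then show ?case by (simp add: bounded_linear.continuous_on[OF assms(2)])
next
  case (Suc k)
  show ?case
  proof (rule Ck_on_SucI[OF assms(1)])
    show "((\<lambda>x. L (f x)) has_derivative (\<lambda>v. L (frechet_derivative f (at x) v))) (at x)"
      if "x \<in> S" for x
      by (rule bounded_linear.has_derivative[OF assms(2) Ck_on_Suc_has_derivative[OF Suc.prems that]])
    show "Ck_on k (\<lambda>x. L (frechet_derivative f (at x) v)) S" for v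
      by (rule Suc.IH) (use Suc.prems Ck_on.simps(2) in blast)
  qed
qed

lemma Ck_on_diff:
  assumes "open S" "Ck_on k f S" "Ck_on k g S"
  shows "Ck_on k (\<lambda>x. f x - g x) S"
proof -
  have "bounded_linear (uminus :: 'b \<Rightarrow> 'b)"
    using bounded_linear_minus[OF bounded_linear_ident] by simp
  then have "Ck_on k (\<lambda>x. - g x) S"
    by (rule Ck_on_bounded_linear[OF assms(1) _ assms(3)])
  with Ck_on_add[OF assms(1,2), of "\<lambda>x. - g x"] show ?thesis
    by simp
qed

lemma Ck_on_mult:
  fixes f g :: "'a::real_normed_vector \<Rightarrow> 'b::real_normed_algebra"
  assumes "open S" "Ck_on k f S" "Ck_on k g S"
  shows "Ck_on k (\<lambda>x. f x * g x) S"
  using assms(2,3)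
proof (induction k arbitrary: f g)
  case 0
  then show ?case by (simp add: continuous_on_mult)
next
  case (Suc k)
  show ?case
  proof (rule Ck_on_SucI[OF assms(1)])
    show "((\<lambda>x. f x * g x) has_derivative
        (\<lambda>v. f x * frechet_derivative g (at x) v + frechet_derivative f (at x) v * g x)) (at x)"
      if "x \<in> S" for x
      by (rule has_derivative_mult[OF Suc.prems[THEN Ck_on_Suc_has_derivative, OF that]])
    show "Ck_on k (\<lambda>x. f x * frechet_derivative g (at x) v
        + frechet_derivative f (at x) v * g x) S" for v
    proof -
      \<comment> \<open>The product rule keeps the undifferentiated factors, which must be lowered
        to order \<open>k\<close> before the induction hypothesis applies.\<close>
      have "Ck_on k f S" "Ck_on k g S"
        using Suc.prems Ck_on_Suc_D by blast+
      with Suc show ?thesis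
        by (intro Ck_on_add[OF assms(1)] Suc.IH) auto
    qed
  qed
qed

text \<open>For an affine inner map the derivative in direction \<open>v\<close> is the derivative
  of \<open>f\<close> in the fixed direction \<open>L v\<close>, composed with the same map, so the
  induction closes without products. It serves the rescaled bumps and the embedding of a time slice
  into space-time.\<close>

lemma Ck_on_compose_affine:
  assumes "open S" "open T" "bounded_linear L" "\<And>y. y \<in> T \<Longrightarrow> L y + c \<in> S" "Ck_on k f S"
  shows "Ck_on k (\<lambda>y. f (L y + c)) T"
  using assms(5)
proof (induction k arbitrary: f)
  case 0
  have "continuous_on T (\<lambda>y. L y + c)"
    by (intro continuous_on_add linear_continuous_on assms(3) continuous_on_const)
  with 0 assms(4) show ?case
    by (auto intro: continuous_on_compose2[of S f])
next
  case (Suc k)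
  show ?case
  proof (rule Ck_on_SucI[OF assms(2)])
    show "((\<lambda>y. f (L y + c)) has_derivative (\<lambda>v. frechet_derivative f (at (L y + c)) (L v))) (at y)"
      if "y \<in> T" for y
    proof (rule has_derivative_compose[where f = "\<lambda>y. L y + c" and g = f])
      show "((\<lambda>y. L y + c) has_derivative L) (at y)"
        using bounded_linear_imp_has_derivative[OF assms(3)] by (rule has_derivative_add_const)
      show "(f has_derivative frechet_derivative f (at (L y + c))) (at (L y + c))"
        using Suc.prems assms(4) that Ck_on_Suc_has_derivative by blast
    qed
    show "Ck_on k (\<lambda>y. frechet_derivative f (at (L y + c)) (L v)) T" for v
      by (rule Suc.IH) (use Suc.prems Ck_on.simps(2) in blast)
  qed
qed

section \<open>Smooth functions and their derivatives\<close>

lemma smooth_on_D: "smooth_on f S \<Longrightarrow> Ck_on k f S"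
  by (simp add: smooth_on_def)

lemma smooth_on_frechet_derivative:
  "smooth_on f S \<Longrightarrow> smooth_on (\<lambda>x. frechet_derivative f (at x) v) S"
  unfolding smooth_on_def using Ck_on.simps(2) by blast

lemma smooth_on_has_derivative:
  "smooth_on f S \<Longrightarrow> x \<in> S \<Longrightarrow> (f has_derivative frechet_derivative f (at x)) (at x)"
  using Ck_on_Suc_has_derivative smooth_on_D by blast

lemma smooth_on_continuous_on: "smooth_on f S \<Longrightarrow> continuous_on S f"
  using Ck_on_imp_continuous_on smooth_on_D by blast


section \<open>Symmetry of second derivatives\<close>

lemma has_real_derivative_along_line:
  fixes f :: "'a::real_normed_vector \<Rightarrow> real"
  assumes "(f has_derivative f') (at (y + s *\<^sub>R v))"
  shows "((\<lambda>s. f (y + s *\<^sub>R v)) has_real_derivative f' v) (at s)"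
proof -
  have "((\<lambda>s. f (y + s *\<^sub>R v)) has_derivative (\<lambda>h. f' (h *\<^sub>R v))) (at s)"
    by (rule has_derivative_compose[where f = "\<lambda>s. y + s *\<^sub>R v", OF _ assms])
      (auto intro!: derivative_eq_intros)
  moreover have "f' (h *\<^sub>R v) = f' v * h" for h
    using assms by (simp add: has_derivative_linear linear_cmul)
  ultimately show ?thesis
    by (simp add: has_field_derivative_def)
qed

text \<open>The mean value theorem is used twice: in direction \<open>u\<close> for the difference
  of \<open>w\<close> along the two sides parallel to \<open>u\<close>, then in direction
  \<open>v\<close> for the derivative so obtained. The left side is symmetric in \<open>u\<close>
  and \<open>v\<close>, the right side is not yet; this yields the symmetry of second
  derivatives.\<close>

lemma second_difference_mean_value:
  fixes w :: "'a::real_normed_vector \<Rightarrow> real"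
  assumes w: "Ck_on 2 w S" and "h > 0"
    and S: "\<And>s t. \<bar>s\<bar> \<le> h \<Longrightarrow> \<bar>t\<bar> \<le> h \<Longrightarrow> x + s *\<^sub>R u + t *\<^sub>R v \<in> S"
  obtains a b where "\<bar>a\<bar> \<le> h" "\<bar>b\<bar> \<le> h"
    "w (x + h *\<^sub>R u + h *\<^sub>R v) - w (x + h *\<^sub>R u) - w (x + h *\<^sub>R v) + w x
      = h\<^sup>2 * frechet_derivative (\<lambda>y. frechet_derivative w (at y) u) (at (x + a *\<^sub>R u + b *\<^sub>R v)) v"
proof -
  let ?D = "\<lambda>y. frechet_derivative w (at y) u"
  have w1: "(w has_derivative frechet_derivative w (at y)) (at y)" if "y \<in> S" for y
    using Ck_on_Suc_has_derivative[of 1 w S] w that by (simp add: numeral_2_eq_2)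
  have w2: "(?D has_derivative frechet_derivative ?D (at y)) (at y)" if "y \<in> S" for y
    using Ck_on_Suc_has_derivative[of 0 ?D S] w that by (simp add: numeral_2_eq_2)
  have d1: "((\<lambda>s. w (x + s *\<^sub>R u + h *\<^sub>R v) - w (x + s *\<^sub>R u)) has_real_derivative
      ?D (x + s *\<^sub>R u + h *\<^sub>R v) - ?D (x + s *\<^sub>R u)) (at s)" if "\<bar>s\<bar> \<le> h" for s
  proof (rule DERIV_diff)
    have "x + h *\<^sub>R v + s *\<^sub>R u \<in> S" "x + s *\<^sub>R u \<in> S"
      using S[of s h] S[of s 0] that \<open>h > 0\<close> by (auto simp: algebra_simps)
    from this[THEN w1, THEN has_real_derivative_along_line]
    show "((\<lambda>s. w (x + s *\<^sub>R u + h *\<^sub>R v)) has_real_derivative ?D (x + s *\<^sub>R u + h *\<^sub>R v)) (at s)"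
      "((\<lambda>s. w (x + s *\<^sub>R u)) has_real_derivative ?D (x + s *\<^sub>R u)) (at s)"
      by (simp_all add: algebra_simps)
  qed
  obtain a where a: "0 < a" "a < h"
    and 1: "w (x + h *\<^sub>R u + h *\<^sub>R v) - w (x + h *\<^sub>R u) - (w (x + 0 *\<^sub>R u + h *\<^sub>R v) - w (x + 0 *\<^sub>R u))
      = (h - 0) * (?D (x + a *\<^sub>R u + h *\<^sub>R v) - ?D (x + a *\<^sub>R u))"
    using MVT2[OF \<open>h > 0\<close>, OF d1] by auto
  have d2: "((\<lambda>t. ?D (x + a *\<^sub>R u + t *\<^sub>R v)) has_real_derivative
      frechet_derivative ?D (at (x + a *\<^sub>R u + t *\<^sub>R v)) v) (at t)" if "\<bar>t\<bar> \<le> h" for t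
    using that a S[of a t] by (intro has_real_derivative_along_line w2) auto
  obtain b where b: "0 < b" "b < h"
    and 2: "?D (x + a *\<^sub>R u + h *\<^sub>R v) - ?D (x + a *\<^sub>R u + 0 *\<^sub>R v)
      = (h - 0) * frechet_derivative ?D (at (x + a *\<^sub>R u + b *\<^sub>R v)) v"
    using MVT2[OF \<open>h > 0\<close>, OF d2] by auto
  show ?thesis
    using that[of a b] a b 1 2 by (simp add: power2_eq_square algebra_simps)
qed

text \<open>The same second difference equals \<open>h\<^sup>2\<close> times either mixed derivative
  at points near \<open>x\<close>; continuity then excludes a gap between the two at
  \<open>x\<close>.\<close>

lemma frechet_derivative_commute:
  fixes w :: "'a::real_normed_vector \<Rightarrow> real"
  assumes "open S" and w: "Ck_on 2 w S" and x: "x \<in> S"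
  shows "frechet_derivative (\<lambda>y. frechet_derivative w (at y) u) (at x) v
    = frechet_derivative (\<lambda>y. frechet_derivative w (at y) v) (at x) u"
    (is "?A x = ?B x")
proof (rule ccontr)
  assume ne: "?A x \<noteq> ?B x"
  \<comment> \<open>Half the gap: the two continuity errors, each below \<open>e\<close>, cannot
    bridge it.\<close>
  define e where "e = \<bar>?A x - ?B x\<bar> / 2"
  have "e > 0" using ne by (simp add: e_def)
  have "continuous_on S ?A" "continuous_on S ?B"
    using w by (auto simp: numeral_2_eq_2)
  then have "(?A \<longlongrightarrow> ?A x) (nhds x)" "(?B \<longlongrightarrow> ?B x) (nhds x)"
    using assms(1) x
    by (simp_all add: continuous_on_eq_continuous_at isCont_def
        tendsto_at_iff_tendsto_nhds[of ?A] tendsto_at_iff_tendsto_nhds[of ?B])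
  then have "eventually (\<lambda>y. y \<in> S \<and> dist (?A y) (?A x) < e \<and> dist (?B y) (?B x) < e) (nhds x)"
    using \<open>e > 0\<close> assms(1) x
    by (intro eventually_conj eventually_nhds_in_open tendstoD)
  then obtain d where "d > 0" and
    d: "\<And>y. dist y x < d \<Longrightarrow> y \<in> S \<and> dist (?A y) (?A x) < e \<and> dist (?B y) (?B x) < e"
    unfolding eventually_nhds_metric by blast
  \<comment> \<open>Keeps every point of the parallelogram within \<open>d / 2\<close> of
    \<open>x\<close>; the summand 1 covers \<open>u = v = 0\<close>.\<close>
  define h where "h = d / (2 * (norm u + norm v + 1))"
  have n: "norm u + norm v + 1 > 0" by (simp add: add_nonneg_pos)
  then have "h > 0" using \<open>d > 0\<close> by (simp add: h_def)
  have near: "dist (x + s *\<^sub>R u + t *\<^sub>R v) x < d" if "\<bar>s\<bar> \<le> h" "\<bar>t\<bar> \<le> h" for s t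
  proof -
    have "norm (s *\<^sub>R u + t *\<^sub>R v) \<le> h * norm u + h * norm v"
      using that by (intro order_trans[OF norm_triangle_ineq] add_mono) (auto simp: mult_right_mono)
    also have "\<dots> \<le> h * (norm u + norm v + 1)"
      using \<open>h > 0\<close> by (simp add: algebra_simps)
    also have "\<dots> = d / 2" using n by (simp add: h_def field_simps)
    also have "\<dots> < d" using \<open>d > 0\<close> by simp
    finally show ?thesis by (simp add: dist_norm add.assoc)
  qed
  obtain a b where ab: "\<bar>a\<bar> \<le> h" "\<bar>b\<bar> \<le> h"
    "w (x + h *\<^sub>R u + h *\<^sub>R v) - w (x + h *\<^sub>R u) - w (x + h *\<^sub>R v) + w x
      = h\<^sup>2 * ?A (x + a *\<^sub>R u + b *\<^sub>R v)"
    using second_difference_mean_value[OF w \<open>h > 0\<close>, of x u v] near d by metis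
  have near': "dist (x + s *\<^sub>R v + t *\<^sub>R u) x < d" if "\<bar>s\<bar> \<le> h" "\<bar>t\<bar> \<le> h" for s t
    using near[of t s] that by (simp add: algebra_simps)
  obtain a' b' where ab': "\<bar>a'\<bar> \<le> h" "\<bar>b'\<bar> \<le> h"
    "w (x + h *\<^sub>R v + h *\<^sub>R u) - w (x + h *\<^sub>R v) - w (x + h *\<^sub>R u) + w x
      = h\<^sup>2 * ?B (x + a' *\<^sub>R v + b' *\<^sub>R u)"
    using second_difference_mean_value[OF w \<open>h > 0\<close>, of x v u] near' d by metis
  have "x + h *\<^sub>R v + h *\<^sub>R u = x + h *\<^sub>R u + h *\<^sub>R v" by simp
  with ab(3) ab'(3) have "h\<^sup>2 * ?A (x + a *\<^sub>R u + b *\<^sub>R v) = h\<^sup>2 * ?B (x + a' *\<^sub>R v + b' *\<^sub>R u)"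
    by (simp add: algebra_simps)
  then have "?A (x + a *\<^sub>R u + b *\<^sub>R v) = ?B (x + a' *\<^sub>R v + b' *\<^sub>R u)"
    using \<open>h > 0\<close> by simp
  moreover have "dist (?A x) (?A (x + a *\<^sub>R u + b *\<^sub>R v)) < e"
    using d near ab dist_commute by metis
  moreover have "dist (?B x) (?B (x + a' *\<^sub>R v + b' *\<^sub>R u)) < e"
    using d near' ab' dist_commute by metis
  ultimately have "dist (?A x) (?B x) < e + e"
    by (intro dist_triangle_less_add[where y = "?A (x + a *\<^sub>R u + b *\<^sub>R v)"]) simp_all
  then show False
    by (simp add: e_def dist_real_def)
qed


section \<open>Test functions approximating the indicator of a box\<close>

text \<open>The functions \<open>flat_exp n\<close> are closed under differentiation up to linear combinations,
  which makes the smoothness of \<open>flat_exp 0\<close> an easy induction.\<close>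

definition flat_exp :: "nat \<Rightarrow> real \<Rightarrow> real" where
  "flat_exp n t = (if t > 0 then exp (- inverse t) * inverse t ^ n else 0)"

text \<open>With y = 1/t, the limit from the right is that of y^n / exp y at infinity; from the left
  the function is zero.\<close>

lemma tendsto_flat_exp_0: "(flat_exp n \<longlongrightarrow> 0) (at 0)"
proof -
  have "((\<lambda>t::real. inverse t ^ n / exp (inverse t)) \<longlongrightarrow> 0) (at_right 0)"
    by (rule filterlim_compose[OF tendsto_power_div_exp_0 filterlim_inverse_at_top_right])
  then have "(flat_exp n \<longlongrightarrow> 0) (at_right 0)"
    by (rule Lim_transform_eventually)
      (auto simp: eventually_at_right_less flat_exp_def exp_minus field_simps
        intro!: eventually_mono[OF eventually_at_right_less[of 0]])
  moreover have "(flat_exp n \<longlongrightarrow> 0) (at_left 0)"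
    by (rule tendsto_eventually)
      (auto simp: eventually_at_filter flat_exp_def)
  ultimately show ?thesis
    by (simp add: filterlim_at_split)
qed

lemma flat_exp_has_derivative:
  "(flat_exp n has_real_derivative flat_exp (n + 2) t - real n * flat_exp (n + 1) t) (at t)"
proof -
  consider "t > 0" | "t < 0" | "t = 0" by linarith
  then show ?thesis
  proof cases
    case 1
    have "((\<lambda>t. exp (- inverse t) * inverse t ^ n) has_real_derivative
        flat_exp (n + 2) t - real n * flat_exp (n + 1) t) (at t)"
    proof -
      \<comment> \<open>The power rule produces the exponent \<open>n - Suc 0\<close>, which is
        truncated for \<open>n = 0\<close>.\<close>
      have "t * t ^ (n - Suc 0) = (if n = 0 then t else t ^ n)"
        by (cases n) auto
      then show ?thesis using 1
        by (auto intro!: derivative_eq_intros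
            simp: flat_exp_def field_simps power2_eq_square split: if_splits)
    qed
    then show ?thesis
      by (rule has_field_derivative_transform_within_open[of _ _ _ "{0<..}"])
        (use 1 in \<open>auto simp: flat_exp_def\<close>)
  next
    case 2
    have "((\<lambda>t. 0) has_real_derivative flat_exp (n + 2) t - real n * flat_exp (n + 1) t) (at t)"
      using 2 by (auto simp: flat_exp_def)
    then show ?thesis
      by (rule has_field_derivative_transform_within_open[of _ _ _ "{..<0}"])
        (use 2 in \<open>auto simp: flat_exp_def\<close>)
  next
    case 3
    \<comment> \<open>The difference quotient at 0 is again a member of the family, with index
      raised by one.\<close>
    have "((\<lambda>h. (flat_exp n (0 + h) - flat_exp n 0) / h) \<longlongrightarrow> 0) (at 0)"
    proof (rule Lim_transform_eventually[OF tendsto_flat_exp_0[of "Suc n"]])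
      show "\<forall>\<^sub>F h in at 0. flat_exp (Suc n) h = (flat_exp n (0 + h) - flat_exp n 0) / h"
        by (auto simp: eventually_at_filter flat_exp_def field_simps)
    qed
    then show ?thesis
      using 3 by (simp add: DERIV_def flat_exp_def)
  qed
qed

lemma Ck_on_flat_exp: "Ck_on k (flat_exp n) UNIV"
proof (induction k arbitrary: n)
  case 0
  then show ?case
    using flat_exp_has_derivative DERIV_isCont
    by (metis Ck_on.simps(1) continuous_at_imp_continuous_on)
next
  case (Suc k)
  show ?case
  proof (rule Ck_on_SucI)
    show "(flat_exp n has_derivative
        (\<lambda>h. (flat_exp (n + 2) t + (- real n) * flat_exp (n + 1) t) * h)) (at t)" for t
      using flat_exp_has_derivative[of n t] by (simp add: has_field_derivative_def)
    show "Ck_on k (\<lambda>t. (flat_exp (n + 2) t + (- real n) * flat_exp (n + 1) t) * v) UNIV" for v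
      by (intro Ck_on_mult Ck_on_add Ck_on_const Suc open_UNIV)
  qed simp
qed

text \<open>The factor \<open>Suc k\<close> scales the argument, not the box: the zero set is the
  same for all \<open>k\<close>, while exp (-1/((k+1) t)) tends to 1 for each t > 0. All values stay
  in [0, 1], as dominated convergence requires.\<close>

definition box_bump :: "real^'n::finite \<Rightarrow> real^'n \<Rightarrow> nat \<Rightarrow> real^'n \<Rightarrow> real" where
  "box_bump a b k x =
     (\<Prod>i\<in>UNIV. flat_exp 0 (real (Suc k) * (x $ i - a $ i)) * flat_exp 0 (real (Suc k) * (b $ i - x $ i)))"

lemma Ck_on_prod:
  fixes f :: "'i \<Rightarrow> 'a::real_normed_vector \<Rightarrow> real"
  assumes "open S" "finite I" "\<And>i. i \<in> I \<Longrightarrow> Ck_on k (f i) S"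
  shows "Ck_on k (\<lambda>x. \<Prod>i\<in>I. f i x) S"
  using assms(2,3) by (induction) (auto intro: Ck_on_const Ck_on_mult[OF assms(1)])

lemma box_bump_bounds: "0 \<le> box_bump a b k x" "box_bump a b k x \<le> 1"
proof -
  have "0 \<le> flat_exp 0 t \<and> flat_exp 0 t \<le> 1" for t
    by (auto simp: flat_exp_def)
  then show "0 \<le> box_bump a b k x" "box_bump a b k x \<le> 1"
    unfolding box_bump_def by (auto intro!: prod_nonneg prod_le_1 mult_le_one)
qed

lemma box_bump_eq_0: "x \<notin> box a b \<Longrightarrow> box_bump a b k x = 0"
proof -
  assume "x \<notin> box a b"
  then obtain i where "\<not> (a $ i < x $ i \<and> x $ i < b $ i)"
    by (auto simp: mem_box_cart)
  then have "flat_exp 0 (real (Suc k) * (x $ i - a $ i)) * flat_exp 0 (real (Suc k) * (b $ i - x $ i)) = 0"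
    by (auto simp: flat_exp_def zero_less_mult_iff simp del: of_nat_Suc)
  then show ?thesis
    unfolding box_bump_def by (intro prod_zero) auto
qed

lemma tendsto_box_bump: "(\<lambda>k. box_bump a b k x) \<longlonglongrightarrow> indicator (box a b) x"
proof (cases "x \<in> box a b")
  case True
  have lim: "(\<lambda>k. flat_exp 0 (real (Suc k) * t)) \<longlonglongrightarrow> 1" if "t > 0" for t
  proof -
    have "(\<lambda>k. exp (- (inverse (real (Suc k)) * inverse t))) \<longlonglongrightarrow> exp (- (0 * inverse t))"
      by (intro tendsto_intros LIMSEQ_inverse_real_of_nat)
    then show ?thesis
      using that by (simp add: flat_exp_def zero_less_mult_iff del: of_nat_Suc)
  qed
  have "(\<lambda>k. box_bump a b k x) \<longlonglongrightarrow> (\<Prod>i\<in>(UNIV::'a set). 1 * 1)"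
    unfolding box_bump_def by (intro tendsto_intros lim) (use True in \<open>auto simp: mem_box_cart\<close>)
  then show ?thesis using True by simp
next
  case False
  then show ?thesis by (simp add: box_bump_eq_0)
qed

lemma box_bump_in_test_functions:
  assumes "cbox a b \<subseteq> \<Omega>"
  shows "box_bump a b k \<in> test_functions \<Omega>"
proof -
  have "Ck_on m (\<lambda>x. flat_exp 0 (real (Suc k) * (x $ i - a $ i))
      * flat_exp 0 (real (Suc k) * (b $ i - x $ i))) UNIV" for m i
  proof (intro Ck_on_mult open_UNIV)
    have "bounded_linear (\<lambda>x::real^'a. real (Suc k) * x $ i)"
      by (intro bounded_linear_const_mult bounded_linear_vec_nth)
    moreover have "bounded_linear (\<lambda>x::real^'a. - real (Suc k) * x $ i)"
      by (intro bounded_linear_const_mult bounded_linear_vec_nth)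
    ultimately have
      "Ck_on m (\<lambda>x::real^'a. flat_exp 0 (real (Suc k) * x $ i + - real (Suc k) * a $ i)) UNIV"
      "Ck_on m (\<lambda>x::real^'a. flat_exp 0 (- real (Suc k) * x $ i + real (Suc k) * b $ i)) UNIV"
      using Ck_on_compose_affine[OF open_UNIV open_UNIV _ _ Ck_on_flat_exp[of m 0]] by blast+
    then show "Ck_on m (\<lambda>x. flat_exp 0 (real (Suc k) * (x $ i - a $ i))) UNIV"
      "Ck_on m (\<lambda>x. flat_exp 0 (real (Suc k) * (b $ i - x $ i))) UNIV"
      by (simp_all add: algebra_simps del: of_nat_Suc)
  qed
  then have "smooth_on (box_bump a b k) UNIV"
    unfolding smooth_on_def box_bump_def[abs_def] by (intro allI Ck_on_prod) auto
  moreover have "closure {x. box_bump a b k x \<noteq> 0} \<subseteq> cbox a b"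
    by (intro closure_minimal closed_cbox) (use box_bump_eq_0[of _ a b] box_subset_cbox[of a b] in blast)
  moreover from this have "compact (closure {x. box_bump a b k x \<noteq> 0})"
    by (meson bounded_cbox bounded_subset closed_closure compact_eq_bounded_closed)
  ultimately show ?thesis
    using assms by (auto simp: test_functions_def)
qed


section \<open>Classical gradients are weak gradients\<close>

text \<open>By translation invariance of \<open>lborel\<close> every difference quotient of
  \<open>F\<close> has integral zero, and dominated convergence passes this to the derivative. No
  iterated integrals are involved.\<close>

lemma integral_directional_derivative_eq_0:
  fixes F :: "'a::euclidean_space \<Rightarrow> real"
  assumes der: "\<And>x. (F has_derivative F' x) (at x)"
    and cont: "continuous_on UNIV (\<lambda>x. F' x e)"
    and supp: "\<And>x. norm x > R \<Longrightarrow> F x = 0"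
  shows "(\<integral>x. F' x e \<partial>lborel) = 0"
proof -
  define s where "s k = inverse (real (Suc k))" for k
  define q where "q k x = (F (x + s k *\<^sub>R e) - F x) / s k" for k x
  have s: "0 < s k" "s k \<le> 1" for k
    by (auto simp: s_def inverse_le_1_iff)
  have F_cont: "continuous_on UNIV F"
    using der has_derivative_continuous continuous_at_imp_continuous_on by blast
  have F_int: "integrable lborel F"
  proof -
    have "F = (\<lambda>x. indicator (cball 0 R) x *\<^sub>R F x)"
      using supp by (auto simp: indicator_def fun_eq_iff not_le)
    then show ?thesis
      using borel_integrable_compact[of "cball 0 R" F] continuous_on_subset[OF F_cont]
      by (simp del: real_scaleR_def)
  qed
  have F_meas [measurable]: "F \<in> borel_measurable borel"
    using F_cont by (rule borel_measurable_continuous_onI)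
  have F'_0: "F' x e = 0" if "norm x > R" for x
  proof -
    have "(F has_derivative (\<lambda>_. 0)) (at x)"
    proof (rule has_derivative_transform_within_open[of "\<lambda>_. 0"])
      show "open {x::'a. norm x > R}"
        by (intro open_Collect_less continuous_intros)
    qed (use that supp in auto)
    then show ?thesis
      using der[of x] has_derivative_unique by metis
  qed
  obtain M where M: "\<And>x. norm (F' x e) \<le> M"
  proof -
    have "bounded ((\<lambda>x. F' x e) ` cball 0 R)"
      by (intro compact_imp_bounded compact_continuous_image continuous_on_subset[OF cont]) auto
    then obtain M where "\<forall>x\<in>cball 0 R. norm (F' x e) \<le> M"
      by (auto simp: bounded_iff)
    \<comment> \<open>The ball is empty for negative \<open>R\<close>, in which case
      \<open>M\<close> may be negative.\<close>
    then have "norm (F' x e) \<le> max M 0" for x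
      using F'_0[of x] by (cases "norm x \<le> R") (auto intro: max.coboundedI1)
    then show ?thesis by (rule that)
  qed
  \<comment> \<open>Since \<open>s k \<le> 1\<close>, outside the enlarged ball both points of the
    quotient lie where \<open>F\<close> vanishes; inside, the mean value theorem gives the
    bound.\<close>
  have q_le: "norm (q k x) \<le> M * indicator (cball 0 (R + norm e)) x" for k x
  proof (cases "norm x \<le> R + norm e")
    case True
    obtain z where "F (x + s k *\<^sub>R e) - F (x + 0 *\<^sub>R e) = (s k - 0) * F' (x + z *\<^sub>R e) e"
      using MVT2[OF s(1)[of k], of "\<lambda>s. F (x + s *\<^sub>R e)" "\<lambda>s. F' (x + s *\<^sub>R e) e"]
        has_real_derivative_along_line[OF der] by blast
    then have "q k x = F' (x + z *\<^sub>R e) e"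
      using s(1)[of k] by (simp add: q_def)
    then show ?thesis using M True by simp
  next
    case False
    have "norm (s k *\<^sub>R e) \<le> norm e"
      using s[of k] by (simp add: mult_left_le_one_le)
    then have "norm (x + s k *\<^sub>R e) > R" "norm x > R"
      using False norm_triangle_ineq4[of "x + s k *\<^sub>R e" "s k *\<^sub>R e"] norm_ge_zero[of e]
      unfolding add_diff_cancel_right' by linarith+
    then show ?thesis using False supp by (simp add: q_def)
  qed
  have "(\<lambda>k. \<integral>x. q k x \<partial>lborel) \<longlonglongrightarrow> (\<integral>x. F' x e \<partial>lborel)"
  proof (rule integral_dominated_convergence)
    show "(\<lambda>x. F' x e) \<in> borel_measurable lborel"
      using borel_measurable_continuous_onI[OF cont] by simp
    show "q k \<in> borel_measurable lborel" for k
      unfolding q_def[abs_def] by measurable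
    show "integrable lborel (\<lambda>x. M * indicator (cball 0 (R + norm e)) x)"
      by (intro integrable_mult_right integrable_real_indicator emeasure_lborel_cball_finite) simp
    have "(\<lambda>k. q k x) \<longlonglongrightarrow> F' x e" for x
    proof -
      have "((\<lambda>h. (F (x + h *\<^sub>R e) - F x) / h) \<longlongrightarrow> F' x e) (at 0)"
        using has_real_derivative_along_line[of F "F' x" x 0 e] der by (simp add: DERIV_def)
      moreover have "filterlim s (at 0) sequentially"
        using LIMSEQ_inverse_real_of_nat s(1)
        by (auto simp: filterlim_at s_def[abs_def])
      ultimately show ?thesis
        unfolding q_def by (rule filterlim_compose)
    qed
    then show "AE x in lborel. (\<lambda>k. q k x) \<longlonglongrightarrow> F' x e" by simp
    show "AE x in lborel. norm (q k x) \<le> M * indicator (cball 0 (R + norm e)) x" for k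
      using q_le by simp
  qed
  moreover have "(\<integral>x. q k x \<partial>lborel) = 0" for k
  proof -
    have "(\<integral>x. F (x + s k *\<^sub>R e) \<partial>lborel) = (\<integral>x. F x \<partial>distr lborel borel ((+) (s k *\<^sub>R e)))"
      by (subst integral_distr) (auto simp: add.commute)
    then have eq: "(\<integral>x. F (x + s k *\<^sub>R e) \<partial>lborel) = (\<integral>x. F x \<partial>lborel)"
      by (simp add: lborel_distr_plus)
    have "integrable (distr lborel borel ((+) (s k *\<^sub>R e))) F"
      using F_int by (simp add: lborel_distr_plus)
    then have "integrable lborel (\<lambda>x. F (x + s k *\<^sub>R e))"
      by (subst (asm) integrable_distr_eq) (auto simp: add.commute)
    then show ?thesis
      using F_int eq by (simp add: q_def)
  qed
  ultimately show ?thesis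
    by (simp add: LIMSEQ_const_iff)
qed

section \<open>Integrability on compact sets and supports of test functions\<close>

lemma absolutely_integrable_continuous_on_compact:
  fixes f :: "'a::euclidean_space \<Rightarrow> 'b::euclidean_space"
  assumes "compact K" "continuous_on K f"
  shows "f absolutely_integrable_on K"
proof -
  have "integrable lborel (\<lambda>x. indicator K x *\<^sub>R f x)"
    using assms by (rule borel_integrable_compact)
  then show ?thesis
    unfolding set_integrable_def
    by (subst integrable_completion) (auto dest: borel_measurable_integrable)
qed

lemma locally_integrable_continuous_on:
  assumes "continuous_on \<Omega> f" shows "locally_integrable_on f \<Omega>"
  unfolding locally_integrable_on_def
  using assms absolutely_integrable_continuous_on_compact continuous_on_subset by blast

lemma integrable_lebesgue_on_compact_support:
  fixes f :: "'a::euclidean_space \<Rightarrow> 'b::euclidean_space"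
  assumes "open \<Omega>" "f absolutely_integrable_on K" "K \<subseteq> \<Omega>" "\<And>x. x \<in> \<Omega> - K \<Longrightarrow> f x = 0"
  shows "integrable (lebesgue_on \<Omega>) f"
proof -
  have "(\<lambda>x. indicator \<Omega> x *\<^sub>R f x) = (\<lambda>x. indicator K x *\<^sub>R f x)"
    using assms(3,4) by (force simp: indicator_def fun_eq_iff)
  then show ?thesis
    using assms(1,2) by (subst integrable_restrict_space) (auto simp: set_integrable_def)
qed

text \<open>The closed support is used, not the set of nonzero values, because its complement is
  open: there the derivative vanishes along with the function.\<close>

lemma test_functions_support:
  assumes "\<phi> \<in> test_functions \<Omega>"
  obtains K where "compact K" "K \<subseteq> \<Omega>" "\<And>x. x \<notin> K \<Longrightarrow> \<phi> x = 0"
    "\<And>x v. x \<notin> K \<Longrightarrow> frechet_derivative \<phi> (at x) v = 0"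
proof -
  let ?K = "closure {x. \<phi> x \<noteq> 0}"
  have 0: "\<phi> x = 0" if "x \<notin> ?K" for x
    using that closure_subset[of "{x. \<phi> x \<noteq> 0}"] by auto
  have "frechet_derivative \<phi> (at x) v = 0" if "x \<notin> ?K" for x v
  proof (rule frechet_derivative_eqI[where f' = "\<lambda>_. 0"])
    show "(\<phi> has_derivative (\<lambda>_. 0)) (at x)"
    proof (rule has_derivative_transform_within_open[OF has_derivative_const])
      show "open (- ?K)" "x \<in> - ?K" using that by auto
      show "0 = \<phi> y" if "y \<in> - ?K" for y using 0[of y] that by fastforce
    qed
  qed
  moreover have "compact ?K" "?K \<subseteq> \<Omega>"
    using assms unfolding test_functions_def by blast+
  ultimately show ?thesis
    using that[of ?K] 0 by blast
qed

lemma smooth_on_test_function: "\<phi> \<in> test_functions \<Omega> \<Longrightarrow> smooth_on \<phi> UNIV"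
  by (simp add: test_functions_def)

lemma partial_deriv_in_test_functions:
  assumes "\<phi> \<in> test_functions \<Omega>"
  shows "partial_deriv i \<phi> \<in> test_functions \<Omega>"
proof -
  obtain K where K: "compact K" "K \<subseteq> \<Omega>" "\<And>x v. x \<notin> K \<Longrightarrow> frechet_derivative \<phi> (at x) v = 0"
    using test_functions_support[OF assms] by metis
  have "closure {x. partial_deriv i \<phi> x \<noteq> 0} \<subseteq> K"
    using K by (intro closure_minimal compact_imp_closed) (auto simp: partial_deriv_def)
  moreover from this have "compact (closure {x. partial_deriv i \<phi> x \<noteq> 0})"
    using K(1) by (meson bounded_subset closed_closure compact_eq_bounded_closed)
  moreover have "smooth_on (partial_deriv i \<phi>) UNIV"
    unfolding partial_deriv_def[abs_def]
    using smooth_on_frechet_derivative[OF smooth_on_test_function[OF assms]] .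
  ultimately show ?thesis
    using K(2) by (auto simp: test_functions_def)
qed

lemma Ck_on_1_continuous_on_partial_deriv:
  "Ck_on (Suc 0) f \<Omega> \<Longrightarrow> continuous_on \<Omega> (partial_deriv i f)"
  by (simp add: partial_deriv_def[abs_def])

text \<open>The product of \<open>f\<close> and \<phi>, extended by zero, is differentiable on the
  whole space, because \<Omega> and the complement of the support form an open cover. Thus the
  behaviour of \<open>f\<close> near the boundary never enters, and the integral of a derivative of
  the product is zero.\<close>

lemma integral_by_parts_test_function:
  fixes f :: "real^'n::finite \<Rightarrow> real"
  assumes "open \<Omega>" and f: "Ck_on (Suc 0) f \<Omega>" and \<phi>: "\<phi> \<in> test_functions \<Omega>"
  shows "(LINT x|lebesgue_on \<Omega>. f x * partial_deriv i \<phi> x)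
    = - (LINT x|lebesgue_on \<Omega>. partial_deriv i f x * \<phi> x)"
proof -
  obtain K where K: "compact K" "K \<subseteq> \<Omega>" "\<And>x. x \<notin> K \<Longrightarrow> \<phi> x = 0"
    and K': "\<And>x v. x \<notin> K \<Longrightarrow> frechet_derivative \<phi> (at x) v = 0"
    using test_functions_support[OF \<phi>] by metis
  note \<phi>_smooth = smooth_on_test_function[OF \<phi>]
  have \<phi>_cont: "continuous_on S \<phi>" "continuous_on S (partial_deriv i \<phi>)" for S
    using smooth_on_continuous_on[OF \<phi>_smooth] Ck_on_1_continuous_on_partial_deriv[OF smooth_on_D[OF \<phi>_smooth]]
    by (auto intro: continuous_on_subset)
  have f_cont: "continuous_on \<Omega> f" "continuous_on \<Omega> (partial_deriv i f)"
    using f Ck_on_imp_continuous_on Ck_on_1_continuous_on_partial_deriv by blast+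
  define F where "F x = (if x \<in> \<Omega> then f x * \<phi> x else 0)" for x
  define F' where "F' x v = (if x \<in> \<Omega> then f x * frechet_derivative \<phi> (at x) v
      + frechet_derivative f (at x) v * \<phi> x else 0)" for x v
  have "open (- K)" using K(1) by (simp add: compact_imp_closed open_Compl)
  have der: "(F has_derivative F' x) (at x)" for x
  proof (cases "x \<in> \<Omega>")
    case True
    have "((\<lambda>x. f x * \<phi> x) has_derivative (\<lambda>v. f x * frechet_derivative \<phi> (at x) v
      + frechet_derivative f (at x) v * \<phi> x)) (at x)"
      using Ck_on_Suc_has_derivative[OF f True] smooth_on_has_derivative[OF \<phi>_smooth]
      by (intro has_derivative_mult) auto
    then have "(F has_derivative (\<lambda>v. f x * frechet_derivative \<phi> (at x) v
      + frechet_derivative f (at x) v * \<phi> x)) (at x)"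
      by (rule has_derivative_transform_within_open[OF _ \<open>open \<Omega>\<close> True]) (simp add: F_def)
    then show ?thesis
      using True by (simp add: F'_def[abs_def])
  next
    case False
    then have "x \<in> - K" using K(2) by auto
    then have "(F has_derivative (\<lambda>_. 0)) (at x)"
      by (rule has_derivative_transform_within_open[OF has_derivative_const \<open>open (- K)\<close>])
        (simp add: F_def K(3))
    then show ?thesis
      using False by (simp add: F'_def[abs_def])
  qed
  have F'_eq: "F' x (axis i 1) = indicator \<Omega> x *\<^sub>R (f x * partial_deriv i \<phi> x + partial_deriv i f x * \<phi> x)" for x
    by (simp add: F'_def partial_deriv_def)
  have cont: "continuous_on UNIV (\<lambda>x. F' x (axis i 1))"
  proof -
    have "continuous_on \<Omega> (\<lambda>x. f x * partial_deriv i \<phi> x + partial_deriv i f x * \<phi> x)"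
      by (intro continuous_on_add continuous_on_mult f_cont \<phi>_cont)
    then have "continuous_on \<Omega> (\<lambda>x. F' x (axis i 1))"
      by (rule continuous_on_cong[THEN iffD1, rotated -1]) (auto simp: F'_eq)
    moreover have "continuous_on (- K) (\<lambda>x. F' x (axis i 1))"
      by (rule continuous_on_cong[THEN iffD1, OF refl _ continuous_on_const[of _ 0]])
        (simp add: F'_def K K')
    ultimately have "continuous_on (\<Omega> \<union> - K) (\<lambda>x. F' x (axis i 1))"
      using \<open>open \<Omega>\<close> \<open>open (- K)\<close> by (intro continuous_on_open_Un)
    moreover have "\<Omega> \<union> - K = UNIV" using K(2) by auto
    ultimately show ?thesis by simp
  qed
  obtain R where R: "\<And>x. x \<in> K \<Longrightarrow> norm x \<le> R"
    using compact_imp_bounded[OF K(1)] by (auto simp: bounded_iff)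
  have "F x = 0" if "norm x > R" for x
    using R[of x] that K(3)[of x] by (auto simp: F_def)
  from integral_directional_derivative_eq_0[OF der cont this]
  have "(\<integral>x. F' x (axis i 1) \<partial>lborel) = 0" .
  then have "(\<integral>x. F' x (axis i 1) \<partial>lebesgue) = 0"
    using borel_measurable_continuous_onI[OF cont] by (subst integral_completion) auto
  then have "(LINT x|lebesgue_on \<Omega>. f x * partial_deriv i \<phi> x + partial_deriv i f x * \<phi> x) = 0"
    using \<open>open \<Omega>\<close> by (subst integral_restrict_space) (auto simp: F'_eq)
  moreover have "integrable (lebesgue_on \<Omega>) (\<lambda>x. f x * partial_deriv i \<phi> x)"
    "integrable (lebesgue_on \<Omega>) (\<lambda>x. partial_deriv i f x * \<phi> x)"
    using K K' continuous_on_subset[OF f_cont(1) K(2)] continuous_on_subset[OF f_cont(2) K(2)]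
    by (auto intro!: integrable_lebesgue_on_compact_support[OF \<open>open \<Omega>\<close> _ K(2)]
        absolutely_integrable_continuous_on_compact continuous_on_mult \<phi>_cont)
      (simp add: partial_deriv_def)
  ultimately show ?thesis
    by simp
qed

lemma is_weak_gradient_gradient:
  fixes f :: "real^'n::finite \<Rightarrow> real"
  assumes "open \<Omega>" and f: "Ck_on (Suc 0) f \<Omega>"
  shows "is_weak_gradient \<Omega> f (gradient f)"
proof -
  have "continuous_on \<Omega> (gradient f)"
    unfolding gradient_def[abs_def]
    by (intro continuous_on_vec_lambda Ck_on_1_continuous_on_partial_deriv[OF f])
  then show ?thesis
    using assms Ck_on_imp_continuous_on[OF f] integral_by_parts_test_function[OF assms]
    by (auto simp: is_weak_gradient_def locally_integrable_continuous_on gradient_def)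
qed


section \<open>Uniqueness of the weak gradient\<close>

text \<open>Boxes form an intersection-stable generator of the Borel sets, and the sets with zero
  integral are closed under complements and disjoint unions. Uniqueness of densities then compares
  \<open>f\<close> with 0.\<close>

lemma AE_eq_0_if_box_integrals_eq_0:
  fixes f :: "'a::euclidean_space \<Rightarrow> real"
  assumes f: "integrable lborel f" and box: "\<And>a b. (LINT x:box a b|lborel. f x) = 0"
  shows "AE x in lborel. f x = 0"
proof (rule density_unique_real)
  have f_on: "set_integrable lborel A f" if "A \<in> sets borel" for A
    using f that unfolding set_integrable_def by (intro integrable_mult_indicator) auto
  have "(LINT x:A|lborel. f x) = 0" if "A \<in> sets borel" for A
  proof -
    have "Int_stable (range (\<lambda>(a, b). box a b :: 'a set))"
      by (auto simp: Int_stable_def box_Int_box)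
    moreover have "(range (\<lambda>(a, b). box a b :: 'a set)) \<subseteq> Pow UNIV"
      by auto
    moreover have "A \<in> sigma_sets UNIV (range (\<lambda>(a, b). box a b))"
      using that unfolding borel_eq_box by simp
    ultimately show ?thesis
    proof (induction rule: sigma_sets_induct_disjoint)
      case (basic A)
      then show ?case using box by auto
    next
      case empty
      then show ?case by (simp add: set_lebesgue_integral_def)
    next
      case (compl A)
      then have A: "A \<in> sets borel" by (simp add: borel_eq_box)
      \<comment> \<open>Growing boxes exhaust the space, so the total integral is zero; complements
        need this.\<close>
      let ?B = "\<lambda>n::nat. box (- (real n *\<^sub>R One)) (real n *\<^sub>R One) :: 'a set"
      have "incseq ?B"
        by (auto simp: incseq_def subset_box intro!: order_trans[OF _ iffD2[OF of_nat_le_iff]])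
      then have "(\<lambda>n. LINT x:?B n|lborel. f x) \<longlonglongrightarrow> (LINT x:(\<Union>n. ?B n)|lborel. f x)"
        by (intro set_integral_cont_up) (auto simp: f_on)
      then have "(LINT x:UNIV|lborel. f x) = 0"
        unfolding UN_box_eq_UNIV by (simp add: box LIMSEQ_const_iff)
      moreover have "(LINT x:UNIV|lborel. f x)
          = (LINT x:A|lborel. f x) + (LINT x:UNIV - A|lborel. f x)"
        using set_integral_Un[of A "UNIV - A" lborel f] A f_on by simp
      ultimately show ?case using compl by simp
    next
      case (union F)
      then have F: "F i \<in> sets borel" for i
        by (auto simp add: borel_eq_box subset_eq)
      have "(LINT x:(\<Union>i. F i)|lborel. f x) = (\<Sum>i. (LINT x:(F i)|lborel. f x))"
        using F union(1) f_on
        by (intro lebesgue_integral_countable_add) (auto simp: disjoint_family_on_def)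
      then show ?case using union by simp
    qed
  qed
  then show "(LINT x:A|lborel. f x) = (LINT x:A|lborel. 0)" if "A \<in> sets lborel" for A
    using that by simp
qed (use f in auto)

text \<open>Testing with bumps gives zero integrals over boxes whose closure lies in \<Omega>. This
  makes \<open>h\<close> vanish almost everywhere near each point, and a countable covering argument
  makes the exceptional set null.\<close>

lemma fundamental_lemma_calculus_of_variations:
  fixes h :: "real^'n::finite \<Rightarrow> real"
  assumes "open \<Omega>" and h: "locally_integrable_on h \<Omega>"
    and 0: "\<And>\<phi>. \<phi> \<in> test_functions \<Omega> \<Longrightarrow> (LINT x|lebesgue_on \<Omega>. h x * \<phi> x) = 0"
  shows "AE x in lebesgue_on \<Omega>. h x = 0"
proof -
  have box: "(LINT x:box a b|lebesgue. h x) = 0" if ab: "cbox a b \<subseteq> \<Omega>" for a b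
  proof -
    \<comment> \<open>Cutting off to the closed box makes the locally integrable \<open>h\<close>
      integrable; its absolute value then dominates the products with the bumps.\<close>
    define H where "H x = indicator (cbox a b) x * h x" for x
    have H: "integrable lebesgue H"
      using h ab compact_cbox unfolding locally_integrable_on_def set_integrable_def H_def[abs_def]
      by (metis (no_types, lifting) real_scaleR_def ext)
    have H_meas: "H \<in> borel_measurable lebesgue"
      using H by simp
    have bump_meas: "box_bump a b k \<in> borel_measurable lebesgue" for k
    proof -
      have "continuous_on UNIV (box_bump a b k)"
        using box_bump_in_test_functions[OF ab] smooth_on_test_function smooth_on_continuous_on by blast
      then have "box_bump a b k \<in> borel_measurable lborel"
        using borel_measurable_continuous_onI by simp
      then show ?thesis by (rule measurable_completion)
    qed
    have "(\<integral>x. H x * box_bump a b k x \<partial>lebesgue) = 0" for k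
    proof -
      have "(\<integral>x. H x * box_bump a b k x \<partial>lebesgue)
          = (\<integral>x. indicator \<Omega> x *\<^sub>R (h x * box_bump a b k x) \<partial>lebesgue)"
      proof (rule Bochner_Integration.integral_cong[OF refl])
        show "H x * box_bump a b k x = indicator \<Omega> x *\<^sub>R (h x * box_bump a b k x)" for x
          using ab box_bump_eq_0[of x a b k] box_subset_cbox[of a b]
          by (auto simp: H_def indicator_def)
      qed
      also have "\<dots> = (LINT x|lebesgue_on \<Omega>. h x * box_bump a b k x)"
        using \<open>open \<Omega>\<close> by (subst integral_restrict_space) auto
      also have "\<dots> = 0"
        using box_bump_in_test_functions[OF ab] by (rule 0)
      finally show ?thesis .
    qed
    moreover have "(\<lambda>k. \<integral>x. H x * box_bump a b k x \<partial>lebesgue) \<longlonglongrightarrow> (\<integral>x. H x * indicator (box a b) x \<partial>lebesgue)"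
    proof (rule integral_dominated_convergence)
      show "(\<lambda>x. H x * indicator (box a b) x) \<in> borel_measurable lebesgue"
        by (intro borel_measurable_times H_meas borel_measurable_indicator) simp
      show "(\<lambda>x. H x * box_bump a b k x) \<in> borel_measurable lebesgue" for k
        by (intro borel_measurable_times H_meas bump_meas)
      show "integrable lebesgue (\<lambda>x. \<bar>H x\<bar>)"
        using H by (rule integrable_abs)
      show "AE x in lebesgue. (\<lambda>k. H x * box_bump a b k x) \<longlonglongrightarrow> H x * indicator (box a b) x"
        by (intro AE_I2 tendsto_mult tendsto_const tendsto_box_bump)
      show "AE x in lebesgue. norm (H x * box_bump a b k x) \<le> \<bar>H x\<bar>" for k
        using box_bump_bounds[of a b k]
        by (intro AE_I2) (simp add: abs_mult mult_left_le)
    qed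
    ultimately have "(\<integral>x. H x * indicator (box a b) x \<partial>lebesgue) = 0"
      by (simp add: LIMSEQ_const_iff)
    moreover have "H x * indicator (box a b) x = indicator (box a b) x *\<^sub>R h x" for x
      using box_subset_cbox[of a b] by (auto simp: H_def indicator_def)
    ultimately show ?thesis
      by (simp add: set_lebesgue_integral_def)
  qed
  have local: "\<exists>a b. x \<in> box a b \<and> negligible {y \<in> box a b. h y \<noteq> 0}" if "x \<in> \<Omega>" for x
  proof -
    obtain a b where ab: "cbox a b \<subseteq> \<Omega>" and x: "x \<in> box a b"
      using open_contains_cbox[OF \<open>open \<Omega>\<close> \<open>x \<in> \<Omega>\<close>] by metis
    define H where "H y = indicator (box a b) y * h y" for y
    have "h absolutely_integrable_on cbox a b"
      using h ab compact_cbox unfolding locally_integrable_on_def by blast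
    then have "h absolutely_integrable_on box a b"
      by (simp add: absolutely_integrable_on_open_interval)
    then have H: "integrable lebesgue H"
      by (simp add: set_integrable_def H_def[abs_def])
    \<comment> \<open>\<open>H\<close> is only Lebesgue measurable, whereas the criterion through
      box integrals is for \<open>lborel\<close>; hence a Borel representative.\<close>
    then obtain G where G [measurable]: "G \<in> borel_measurable lborel" and GH: "AE y in lebesgue. H y = G y"
      using completion_ex_borel_measurable_real[of H lborel] AE_completion by (metis borel_measurable_integrable)
    have G': "G \<in> borel_measurable lebesgue"
      using G by (rule measurable_completion)
    have "integrable lebesgue G"
      using integrable_cong_AE[THEN iffD1, OF _ G' GH H] H by simp
    then have G_int: "integrable lborel G"
      using G integrable_completion by blast
    have "(LINT y:box c d|lborel. G y) = 0" for c d
    proof -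
      obtain l u where lu: "box a b \<inter> box c d = box l u"
        using box_Int_box by blast
      have "(LINT y:box l u|lebesgue. h y) = 0"
      \<comment> \<open>Only for a nonempty open box is the closed box its closure, and so contained
        in \<open>cbox a b\<close>.\<close>
      proof (cases "box l u = {}")
        case False
        then have "cbox l u \<subseteq> cbox a b"
          using lu closure_mono[of "box l u" "box a b"] by (metis closure_box empty_subsetI inf_le1 subset_empty)
        then show ?thesis using ab box by blast
      qed (simp add: set_lebesgue_integral_def)
      moreover have "(LINT y:box c d|lborel. G y) = (LINT y:box c d|lebesgue. G y)"
        unfolding set_lebesgue_integral_def by (rule integral_completion[symmetric]) simp
      moreover have "(LINT y:box c d|lebesgue. G y) = (LINT y:box c d|lebesgue. H y)"
        unfolding set_lebesgue_integral_def
      proof (rule integral_cong_AE)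
        show "AE y in lebesgue. indicator (box c d) y *\<^sub>R G y = indicator (box c d) y *\<^sub>R H y"
          using GH by eventually_elim simp
      qed (use G' H in \<open>simp_all add: borel_measurable_times borel_measurable_indicator\<close>)
      moreover have "(LINT y:box c d|lebesgue. H y) = (LINT y:box l u|lebesgue. h y)"
        unfolding set_lebesgue_integral_def lu[symmetric]
        by (intro Bochner_Integration.integral_cong) (auto simp: H_def indicator_def)
      ultimately show ?thesis by simp
    qed
    then have "AE y in lborel. G y = 0"
      by (rule AE_eq_0_if_box_integrals_eq_0[OF G_int])
    then have "AE y in lebesgue. G y = 0"
      by (rule AE_completion)
    with GH have "AE y in lebesgue. H y = 0"
      by eventually_elim simp
    then have "negligible {y. H y \<noteq> 0}"
      unfolding eventually_ae_filter_negligible by (blast intro: negligible_subset)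
    then have "negligible {y \<in> box a b. h y \<noteq> 0}"
      by (rule negligible_subset) (auto simp: H_def)
    with x show ?thesis by blast
  qed
  have "\<exists>U. openin (top_of_set {x \<in> \<Omega>. h x \<noteq> 0}) U \<and> x \<in> U \<and> negligible U"
    if x: "x \<in> {x \<in> \<Omega>. h x \<noteq> 0}" for x
  proof -
    obtain a b where "x \<in> box a b" "negligible {y \<in> box a b. h y \<noteq> 0}"
      using local x by blast
    then show ?thesis
      using that by (intro exI[of _ "{x \<in> \<Omega>. h x \<noteq> 0} \<inter> box a b"])
        (auto simp: openin_open_Int elim: negligible_subset)
  qed
  \<comment> \<open>Relatively open null neighbourhoods of all its points make a set null; this is
    the countable covering step.\<close>
  then have "negligible {x \<in> \<Omega>. h x \<noteq> 0}"
    by (subst locally_negligible_alt) blast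
  then have "AE x in lebesgue. x \<in> \<Omega> \<longrightarrow> h x = 0"
    unfolding eventually_ae_filter_negligible by blast
  then show ?thesis
    using \<open>open \<Omega>\<close> by (subst AE_restrict_space_iff) auto
qed

lemma locally_integrable_on_diff:
  "locally_integrable_on f \<Omega> \<Longrightarrow> locally_integrable_on g \<Omega> \<Longrightarrow> locally_integrable_on (\<lambda>x. f x - g x) \<Omega>"
  unfolding locally_integrable_on_def by (blast intro: set_integral_diff(1))

lemma integrable_mult_test_function:
  fixes h :: "real^'n::finite \<Rightarrow> real"
  assumes "open \<Omega>" "locally_integrable_on h \<Omega>" and \<phi>: "\<phi> \<in> test_functions \<Omega>"
  shows "integrable (lebesgue_on \<Omega>) (\<lambda>x. h x * \<phi> x)"
proof -
  obtain K where K: "compact K" "K \<subseteq> \<Omega>" "\<And>x. x \<notin> K \<Longrightarrow> \<phi> x = 0"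
    using test_functions_support[OF \<phi>] by metis
  have cont: "continuous_on UNIV \<phi>"
    using smooth_on_test_function[OF \<phi>] smooth_on_continuous_on by blast
  obtain M where M: "\<And>x. x \<in> K \<Longrightarrow> \<bar>\<phi> x\<bar> \<le> M"
    using compact_imp_bounded[OF compact_continuous_image[OF continuous_on_subset[OF cont] K(1)]]
    by (auto simp: bounded_iff)
  have hK: "integrable lebesgue (\<lambda>x. indicator K x *\<^sub>R h x)"
    using assms(2) K unfolding locally_integrable_on_def set_integrable_def by blast
  have "integrable lebesgue (\<lambda>x. indicator K x *\<^sub>R (h x * \<phi> x))"
  proof (rule Bochner_Integration.integrable_bound)
    show "integrable lebesgue (\<lambda>x. M * (indicator K x *\<^sub>R h x))"
      using hK by (rule integrable_mult_right)
    have "\<phi> \<in> borel_measurable lebesgue"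
      using borel_measurable_continuous_onI[OF cont] by (intro measurable_completion) simp
    then have "(\<lambda>x. (indicator K x *\<^sub>R h x) * \<phi> x) \<in> borel_measurable lebesgue"
      using hK by (intro borel_measurable_times) auto
    then show "(\<lambda>x. indicator K x *\<^sub>R (h x * \<phi> x)) \<in> borel_measurable lebesgue"
      by (simp add: mult.assoc)
    show "AE x in lebesgue. norm (indicator K x *\<^sub>R (h x * \<phi> x)) \<le> norm (M * (indicator K x *\<^sub>R h x))"
    proof (rule AE_I2)
      fix x
      show "norm (indicator K x *\<^sub>R (h x * \<phi> x)) \<le> norm (M * (indicator K x *\<^sub>R h x))"
        using M[of x] by (auto simp: indicator_def abs_mult mult.commute intro!: mult_right_mono)
    qed
  qed
  then show ?thesis
    using K by (intro integrable_lebesgue_on_compact_support[OF assms(1), where K = K]) (auto simp: set_integrable_def)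
qed

text \<open>Both candidates have the same pairings with test functions, so the fundamental lemma
  applies to each component of the difference. This makes the choice in \<open>weak_gradient\<close>
  harmless.\<close>

lemma weak_gradient_unique:
  fixes f :: "real^'n::finite \<Rightarrow> real"
  assumes "open \<Omega>" and g: "is_weak_gradient \<Omega> f g" and g': "is_weak_gradient \<Omega> f g'"
  shows "AE x in lebesgue_on \<Omega>. g x = g' x"
proof -
  have loc: "locally_integrable_on (\<lambda>x. g x $ i) \<Omega>" if "is_weak_gradient \<Omega> f g" for g i
    using that absolutely_integrable_component[where f = g and b = "axis i 1"]
    by (auto simp: is_weak_gradient_def locally_integrable_on_def cart_eq_inner_axis)
  have "AE x in lebesgue_on \<Omega>. g x $ i - g' x $ i = 0" for i
  proof (rule fundamental_lemma_calculus_of_variations[OF \<open>open \<Omega>\<close>])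
    show "locally_integrable_on (\<lambda>x. g x $ i - g' x $ i) \<Omega>"
      by (intro locally_integrable_on_diff loc g g')
    fix \<phi> :: "real^'n \<Rightarrow> real" assume \<phi>: "\<phi> \<in> test_functions \<Omega>"
    have "(LINT x|lebesgue_on \<Omega>. g x $ i * \<phi> x) = (LINT x|lebesgue_on \<Omega>. g' x $ i * \<phi> x)"
      using g g' \<phi> by (auto simp: is_weak_gradient_def)
    then show "(LINT x|lebesgue_on \<Omega>. (g x $ i - g' x $ i) * \<phi> x) = 0"
      using integrable_mult_test_function[OF \<open>open \<Omega>\<close> loc \<phi>] g g'
      by (simp add: left_diff_distrib)
  qed
  then have "AE x in lebesgue_on \<Omega>. \<forall>i\<in>UNIV. g x $ i - g' x $ i = 0"
    by (intro AE_finite_allI) auto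
  then show ?thesis
    by (rule AE_mp) (auto simp: vec_eq_iff intro!: AE_I2)
qed


section \<open>The Jacobian determinant of an \<open>H\<^sup>1\<^sub>0\<close> field has zero mean\<close>

text \<open>The determinant of the matrix with rows \<open>a\<close> and \<open>b\<close>; on the
  gradients of the two velocity components it is the Jacobian determinant.\<close>

definition cross2 :: "real^2 \<Rightarrow> real^2 \<Rightarrow> real" where
  "cross2 a b = a $ 1 * b $ 2 - a $ 2 * b $ 1"

lemma norm_squared_2: "(norm (a :: real^2))\<^sup>2 = (a $ 1)\<^sup>2 + (a $ 2)\<^sup>2"
  by (simp only: power2_norm_eq_inner) (simp add: inner_vec_def sum_2 power2_eq_square)

text \<open>Young's inequality with weight \<open>s\<close>, without the sharp constant, stands in
  for Cauchy-Schwarz: \<open>s = 1\<close> yields integrability, small \<open>s\<close> the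
  limit.\<close>

lemma cross2_le:
  assumes "s > 0" shows "\<bar>cross2 a b\<bar> \<le> s * (norm a)\<^sup>2 + (norm b)\<^sup>2 / s"
proof -
  have "\<bar>x * y\<bar> \<le> s * x\<^sup>2 + y\<^sup>2 / s" for x y :: real
  proof -
    have "0 \<le> (s * \<bar>x\<bar> - \<bar>y\<bar>)\<^sup>2" by simp
    then have "2 * s * (\<bar>x\<bar> * \<bar>y\<bar>) \<le> s\<^sup>2 * x\<^sup>2 + y\<^sup>2"
      by (simp add: power2_diff power_mult_distrib algebra_simps)
    also have "s\<^sup>2 * x\<^sup>2 + y\<^sup>2 = s * (s * x\<^sup>2 + y\<^sup>2 / s)"
      using assms by (simp add: field_simps power2_eq_square)
    finally have "2 * (\<bar>x\<bar> * \<bar>y\<bar>) \<le> s * x\<^sup>2 + y\<^sup>2 / s"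
      using assms by (simp add: mult.assoc mult.left_commute[of 2])
    moreover have "0 \<le> \<bar>x\<bar> * \<bar>y\<bar>" by simp
    ultimately show ?thesis by (simp only: abs_mult)
  qed
  from this[of "a $ 1" "b $ 2"] this[of "a $ 2" "b $ 1"] show ?thesis
    unfolding cross2_def norm_squared_2 by (simp add: field_simps add_divide_distrib)
qed

section \<open>Classical gradients of functions in \<open>H1\<close>\<close>

lemma gradient_measurable:
  assumes "open \<Omega>" "Ck_on (Suc 0) f \<Omega>"
  shows "gradient f \<in> borel_measurable (lebesgue_on \<Omega>)"
proof (rule continuous_imp_measurable_on_sets_lebesgue)
  show "continuous_on \<Omega> (gradient f)"
    unfolding gradient_def[abs_def]
    by (intro continuous_on_vec_lambda Ck_on_1_continuous_on_partial_deriv assms)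
qed (use assms in auto)

lemma is_weak_gradient_AE_gradient:
  fixes f :: "real^'n::finite \<Rightarrow> real"
  assumes "open \<Omega>" "Ck_on (Suc 0) f \<Omega>" "is_weak_gradient \<Omega> f g"
  shows "AE x in lebesgue_on \<Omega>. g x = gradient f x"
  using weak_gradient_unique[OF assms(1,3) is_weak_gradient_gradient[OF assms(1,2)]] .

text \<open>Membership in \<open>H1\<close> speaks of some square-integrable weak gradient;
  uniqueness transfers the integrability to the classical one.\<close>

lemma H1_integrable_gradient:
  fixes f :: "real^'n::finite \<Rightarrow> real"
  assumes "open \<Omega>" "Ck_on (Suc 0) f \<Omega>" "f \<in> H1 \<Omega>"
  shows "integrable (lebesgue_on \<Omega>) (\<lambda>x. (norm (gradient f x))\<^sup>2)"
proof -
  obtain g where g: "g \<in> L2 \<Omega>" "is_weak_gradient \<Omega> f g"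
    using assms(3) by (auto simp: H1_def)
  have AE: "AE x in lebesgue_on \<Omega>. (norm (g x))\<^sup>2 = (norm (gradient f x))\<^sup>2"
    using is_weak_gradient_AE_gradient[OF assms(1,2) g(2)] by eventually_elim simp
  have "integrable (lebesgue_on \<Omega>) (\<lambda>x. (norm (g x))\<^sup>2)"
    using g(1) by (simp add: L2_def)
  moreover have "(\<lambda>x. (norm (gradient f x))\<^sup>2) \<in> borel_measurable (lebesgue_on \<Omega>)"
    using gradient_measurable[OF assms(1,2)] by measurable
  ultimately show ?thesis
    using integrable_cong_AE[OF _ _ AE] by (metis borel_measurable_integrable)
qed

lemma integral_gradient_le_H1_norm:
  fixes f :: "real^'n::finite \<Rightarrow> real"
  assumes "open \<Omega>" "Ck_on (Suc 0) f \<Omega>"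
  shows "(LINT x|lebesgue_on \<Omega>. (norm (gradient f x))\<^sup>2) \<le> (H1_norm \<Omega> f)\<^sup>2"
proof -
  have w: "is_weak_gradient \<Omega> f (weak_gradient \<Omega> f)"
    unfolding weak_gradient_def by (rule someI[of "is_weak_gradient \<Omega> f"]) (rule is_weak_gradient_gradient[OF assms])
  have AE: "AE x in lebesgue_on \<Omega>. weak_gradient \<Omega> f x = gradient f x"
    using is_weak_gradient_AE_gradient[OF assms w] .
  have meas: "gradient f \<in> borel_measurable (lebesgue_on \<Omega>)"
    by (rule gradient_measurable[OF assms])
  \<comment> \<open>Measurability of the chosen function is inherited from the classical gradient,
    since Lebesgue measure is complete.\<close>
  have "weak_gradient \<Omega> f \<in> borel_measurable (lebesgue_on \<Omega>)"
  proof -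
    have "(\<lambda>x. indicator \<Omega> x *\<^sub>R gradient f x) \<in> borel_measurable lebesgue"
      using meas assms(1) by (subst (asm) borel_measurable_restrict_space_iff) auto
    moreover have "AE x in lebesgue. indicator \<Omega> x *\<^sub>R gradient f x = indicator \<Omega> x *\<^sub>R weak_gradient \<Omega> f x"
      using AE assms(1) by (subst (asm) AE_restrict_space_iff) (auto elim: eventually_mono simp: indicator_def)
    ultimately have "(\<lambda>x. indicator \<Omega> x *\<^sub>R weak_gradient \<Omega> f x) \<in> borel_measurable lebesgue"
      by (rule borel_measurable_AE)
    then show ?thesis
      using assms(1) by (subst borel_measurable_restrict_space_iff) auto
  qed
  then have "(LINT x|lebesgue_on \<Omega>. (norm (weak_gradient \<Omega> f x))\<^sup>2)
      = (LINT x|lebesgue_on \<Omega>. (norm (gradient f x))\<^sup>2)"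
    using meas AE by (intro integral_cong_AE) (auto elim: eventually_mono)
  moreover have "(LINT x|lebesgue_on \<Omega>. (f x)\<^sup>2) \<ge> 0" "(LINT x|lebesgue_on \<Omega>. (norm (gradient f x))\<^sup>2) \<ge> 0"
    by (intro integral_nonneg_AE AE_I2; simp)+
  ultimately show ?thesis
    by (simp add: H1_norm_def)
qed

lemma gradient_diff:
  fixes f g :: "real^'n::finite \<Rightarrow> real"
  assumes "f differentiable at x" "g differentiable at x"
  shows "gradient (\<lambda>y. f y - g y) x = gradient f x - gradient g x"
  using frechet_derivative_eqI[OF has_derivative_diff[OF assms[unfolded frechet_derivative_works]]]
  by (simp add: gradient_def partial_deriv_def vec_eq_iff)

text \<open>Integrating by parts against the first derivatives of \<phi>, themselves test functions,
  leaves \<open>f\<close> times the difference of the mixed derivatives of \<phi>, which is zero.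
  All second derivatives fall on \<phi>, as \<open>f\<close> is only C^1.\<close>

lemma integral_cross2_gradient_test_function_eq_0:
  fixes f \<phi> :: "real^2 \<Rightarrow> real"
  assumes "open \<Omega>" and f: "Ck_on (Suc 0) f \<Omega>" and \<phi>: "\<phi> \<in> test_functions \<Omega>"
  shows "integrable (lebesgue_on \<Omega>) (\<lambda>x. cross2 (gradient f x) (gradient \<phi> x))"
    and "(LINT x|lebesgue_on \<Omega>. cross2 (gradient f x) (gradient \<phi> x)) = 0"
proof -
  have int: "integrable (lebesgue_on \<Omega>) (\<lambda>x. partial_deriv i f x * partial_deriv j \<phi> x)" for i j
    by (intro integrable_mult_test_function \<open>open \<Omega>\<close> locally_integrable_continuous_on
        Ck_on_1_continuous_on_partial_deriv f partial_deriv_in_test_functions \<phi>)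
  have eq: "(\<lambda>x. cross2 (gradient f x) (gradient \<phi> x)) =
      (\<lambda>x. partial_deriv 1 f x * partial_deriv 2 \<phi> x - partial_deriv 2 f x * partial_deriv 1 \<phi> x)"
    by (simp add: cross2_def gradient_def)
  show "integrable (lebesgue_on \<Omega>) (\<lambda>x. cross2 (gradient f x) (gradient \<phi> x))"
    unfolding eq by (intro Bochner_Integration.integrable_diff int)
  have "partial_deriv 1 (partial_deriv 2 \<phi>) x = partial_deriv 2 (partial_deriv 1 \<phi>) x" for x
    using frechet_derivative_commute[OF open_UNIV smooth_on_D[OF smooth_on_test_function[OF \<phi>]] UNIV_I]
    unfolding partial_deriv_def[abs_def] by blast
  then show "(LINT x|lebesgue_on \<Omega>. cross2 (gradient f x) (gradient \<phi> x)) = 0"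
    using integral_by_parts_test_function[OF \<open>open \<Omega>\<close> f partial_deriv_in_test_functions[OF \<phi>], of 1 2]
      integral_by_parts_test_function[OF \<open>open \<Omega>\<close> f partial_deriv_in_test_functions[OF \<phi>], of 2 1]
    unfolding eq by (simp add: int)
qed

text \<open>Subtracting a test function from \<open>g\<close> leaves the integral unchanged, so it
  can be bounded by the gradient of a remainder that is as small as desired.\<close>

lemma integral_cross2_gradient_H10_eq_0:
  fixes f g :: "real^2 \<Rightarrow> real"
  assumes "open \<Omega>" and C: "Ck_on (Suc 0) f \<Omega>" "Ck_on (Suc 0) g \<Omega>" and f: "f \<in> H1 \<Omega>" and g: "g \<in> H10 \<Omega>"
  shows "integrable (lebesgue_on \<Omega>) (\<lambda>x. cross2 (gradient f x) (gradient g x))"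
    and "(LINT x|lebesgue_on \<Omega>. cross2 (gradient f x) (gradient g x)) = 0"
proof -
  let ?M = "lebesgue_on \<Omega>"
  have meas: "gradient f \<in> borel_measurable ?M" "gradient g \<in> borel_measurable ?M"
    using gradient_measurable[OF \<open>open \<Omega>\<close>] C by auto
  have int_f: "integrable ?M (\<lambda>x. (norm (gradient f x))\<^sup>2)"
    using H1_integrable_gradient[OF \<open>open \<Omega>\<close> C(1) f] .
  have int_g: "integrable ?M (\<lambda>x. (norm (gradient g x))\<^sup>2)"
    using H1_integrable_gradient[OF \<open>open \<Omega>\<close> C(2)] g by (simp add: H10_def)
  show int: "integrable ?M (\<lambda>x. cross2 (gradient f x) (gradient g x))"
  proof (rule Bochner_Integration.integrable_bound)
    show "integrable ?M (\<lambda>x. (norm (gradient f x))\<^sup>2 + (norm (gradient g x))\<^sup>2)"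
      using int_f int_g by (rule Bochner_Integration.integrable_add)
    show "(\<lambda>x. cross2 (gradient f x) (gradient g x)) \<in> borel_measurable ?M"
      unfolding cross2_def cart_eq_inner_axis
      by (intro borel_measurable_diff borel_measurable_times borel_measurable_inner meas borel_measurable_const)
    show "AE x in ?M. norm (cross2 (gradient f x) (gradient g x))
        \<le> norm ((norm (gradient f x))\<^sup>2 + (norm (gradient g x))\<^sup>2)"
      using cross2_le[of 1] by (intro AE_I2) simp
  qed
  let ?A = "LINT x|?M. (norm (gradient f x))\<^sup>2"
  have bound: "\<bar>LINT x|?M. cross2 (gradient f x) (gradient g x)\<bar> \<le> s * (?A + 1)" if "s > 0" for s
  proof -
    \<comment> \<open>The accuracy equals the weight in Young's inequality, so the term divided by
      \<open>s\<close> is at most \<open>s\<^sup>2 / s = s\<close>.\<close>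
    obtain \<phi> where \<phi>: "\<phi> \<in> test_functions \<Omega>" and s: "H1_norm \<Omega> (\<lambda>x. g x - \<phi> x) < s"
      using g \<open>s > 0\<close> by (auto simp: H10_def)
    have \<phi>_smooth: "smooth_on \<phi> UNIV"
      using \<phi> by (rule smooth_on_test_function)
    have C\<phi>: "Ck_on (Suc 0) \<phi> \<Omega>"
      using smooth_on_D[OF \<phi>_smooth] Ck_on_subset subset_UNIV by blast
    let ?d = "\<lambda>x. g x - \<phi> x"
    have Cd: "Ck_on (Suc 0) ?d \<Omega>"
      using \<open>open \<Omega>\<close> C(2) C\<phi> by (rule Ck_on_diff)
    have grad_d: "gradient ?d x = gradient g x - gradient \<phi> x" if "x \<in> \<Omega>" for x
      using C(2) C\<phi> that by (intro gradient_diff) auto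
    have int_\<phi>: "integrable ?M (\<lambda>x. (norm (gradient \<phi> x))\<^sup>2)"
    proof -
      have "integrable ?M (\<lambda>x. partial_deriv i \<phi> x * partial_deriv i \<phi> x)" for i
        by (intro integrable_mult_test_function \<open>open \<Omega>\<close> locally_integrable_continuous_on
            Ck_on_1_continuous_on_partial_deriv C\<phi> partial_deriv_in_test_functions \<phi>)
      then show ?thesis
        unfolding norm_squared_2 by (simp add: gradient_def power2_eq_square)
    qed
    have int_d: "integrable ?M (\<lambda>x. (norm (gradient ?d x))\<^sup>2)"
    proof (rule Bochner_Integration.integrable_bound)
      show "integrable ?M (\<lambda>x. 2 * (norm (gradient g x))\<^sup>2 + 2 * (norm (gradient \<phi> x))\<^sup>2)"
        by (intro Bochner_Integration.integrable_add integrable_mult_right int_g int_\<phi>)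
      show "(\<lambda>x. (norm (gradient ?d x))\<^sup>2) \<in> borel_measurable ?M"
        using gradient_measurable[OF \<open>open \<Omega>\<close> Cd] by measurable
      have "(norm (a - b))\<^sup>2 \<le> 2 * (norm a)\<^sup>2 + 2 * (norm b)\<^sup>2" for a b :: "real^2"
        using zero_le_power2[of "a $ 1 + b $ 1"] zero_le_power2[of "a $ 2 + b $ 2"]
        unfolding norm_squared_2 by (simp add: power2_sum power2_diff)
      then show "AE x in ?M. norm ((norm (gradient ?d x))\<^sup>2)
          \<le> norm (2 * (norm (gradient g x))\<^sup>2 + 2 * (norm (gradient \<phi> x))\<^sup>2)"
        by (intro AE_I2) (simp add: space_restrict_space grad_d)
    qed
    note \<phi>_0 = integral_cross2_gradient_test_function_eq_0[OF \<open>open \<Omega>\<close> C(1) \<phi>]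
    have eq: "cross2 (gradient f x) (gradient ?d x)
        = cross2 (gradient f x) (gradient g x) - cross2 (gradient f x) (gradient \<phi> x)" if "x \<in> \<Omega>" for x
      by (simp add: grad_d[OF that] cross2_def algebra_simps)
    have int_fd: "integrable ?M (\<lambda>x. cross2 (gradient f x) (gradient ?d x))"
      using Bochner_Integration.integrable_diff[OF int \<phi>_0(1)]
      by (rule Bochner_Integration.integrable_cong[THEN iffD2, rotated -1]) (auto simp: eq space_restrict_space)
    have "(LINT x|?M. cross2 (gradient f x) (gradient ?d x))
        = (LINT x|?M. cross2 (gradient f x) (gradient g x) - cross2 (gradient f x) (gradient \<phi> x))"
      by (intro Bochner_Integration.integral_cong) (auto simp: eq space_restrict_space)
    also have "\<dots> = (LINT x|?M. cross2 (gradient f x) (gradient g x))"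
      using int \<phi>_0 by simp
    finally have "\<bar>LINT x|?M. cross2 (gradient f x) (gradient g x)\<bar>
        = \<bar>LINT x|?M. cross2 (gradient f x) (gradient ?d x)\<bar>"
      by simp
    also have "\<dots> \<le> (LINT x|?M. \<bar>cross2 (gradient f x) (gradient ?d x)\<bar>)"
      by (rule integral_abs_bound)
    also have "\<dots> \<le> (LINT x|?M. s * (norm (gradient f x))\<^sup>2 + (norm (gradient ?d x))\<^sup>2 / s)"
      using int_fd int_f int_d \<open>s > 0\<close> by (intro integral_mono cross2_le) auto
    also have "\<dots> = s * ?A + (LINT x|?M. (norm (gradient ?d x))\<^sup>2) / s"
      using int_f int_d by simp
    also have "\<dots> \<le> s * ?A + s\<^sup>2 / s"
    proof -
      have "(H1_norm \<Omega> ?d)\<^sup>2 \<le> s\<^sup>2"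
        using s by (intro power_mono) (auto simp: H1_norm_def intro!: integral_nonneg_AE add_nonneg_nonneg)
      then show ?thesis
        using integral_gradient_le_H1_norm[OF \<open>open \<Omega>\<close> Cd] \<open>s > 0\<close>
        by (intro add_left_mono divide_right_mono) auto
    qed
    also have "\<dots> = s * (?A + 1)"
      using \<open>s > 0\<close> by (simp add: power2_eq_square algebra_simps)
    finally show ?thesis .
  qed
  have "?A \<ge> 0"
    by (intro integral_nonneg_AE AE_I2) simp
  then have A: "?A + 1 > 0" by linarith
  have "\<bar>LINT x|?M. cross2 (gradient f x) (gradient g x)\<bar> \<le> 0 + e" if "e > 0" for e
  proof -
    have "e / (?A + 1) > 0" using that A by (rule divide_pos_pos)
    then have "\<bar>LINT x|?M. cross2 (gradient f x) (gradient g x)\<bar> \<le> e / (?A + 1) * (?A + 1)"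
      by (rule bound)
    also have "e / (?A + 1) * (?A + 1) = e"
      using nonzero_divide_eq_eq[THEN iffD1, OF _ refl, symmetric] A less_irrefl by metis
    finally show ?thesis by simp
  qed
  then have "\<bar>LINT x|?M. cross2 (gradient f x) (gradient g x)\<bar> \<le> 0"
    by (rule field_le_epsilon)
  then show "(LINT x|?M. cross2 (gradient f x) (gradient g x)) = 0"
    by simp
qed


section \<open>The Poisson equation for the pressure\<close>

text \<open>With the direction first, \<open>dir_deriv v\<close> is an operator on functions and can
  be iterated; time and space derivatives are the same operator in different directions.\<close>

definition dir_deriv :: "'a \<Rightarrow> ('a::real_normed_vector \<Rightarrow> 'b::real_normed_vector) \<Rightarrow> 'a \<Rightarrow> 'b" where
  "dir_deriv v w z = frechet_derivative w (at z) v"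

lemma smooth_on_dir_deriv: "smooth_on w Q \<Longrightarrow> smooth_on (dir_deriv v w) Q"
  unfolding dir_deriv_def[abs_def] by (rule smooth_on_frechet_derivative)

lemma smooth_on_has_dir_deriv: "smooth_on w Q \<Longrightarrow> z \<in> Q \<Longrightarrow> (w has_derivative (\<lambda>h. dir_deriv h w z)) (at z)"
  using smooth_on_has_derivative by (simp add: dir_deriv_def)

lemma dir_deriv_commute:
  fixes w :: "'a::real_normed_vector \<Rightarrow> real"
  assumes "open Q" "smooth_on w Q" "z \<in> Q"
  shows "dir_deriv a (dir_deriv b w) z = dir_deriv b (dir_deriv a w) z"
  using frechet_derivative_commute[OF assms(1) smooth_on_D[OF assms(2)] assms(3)]
  by (simp add: dir_deriv_def[abs_def])

lemma dir_deriv_cong: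
  assumes "open Q" "z \<in> Q" "smooth_on f Q" "\<And>x. x \<in> Q \<Longrightarrow> f x = g x"
  shows "dir_deriv v f z = dir_deriv v g z"
proof -
  have "(g has_derivative (\<lambda>h. dir_deriv h f z)) (at z)"
    by (rule has_derivative_transform_within_open[OF smooth_on_has_dir_deriv[OF assms(3,2)] assms(1,2,4)])
  then show ?thesis
    using frechet_derivative_eqI unfolding dir_deriv_def by metis
qed

lemma derivative_eq_0_on_open:
  assumes "open Q" "z \<in> Q" "\<And>x. x \<in> Q \<Longrightarrow> f x = 0" "(f has_derivative f') (at z)"
  shows "f' v = 0"
proof -
  have "(f has_derivative (\<lambda>_. 0)) (at z)"
    by (rule has_derivative_transform_within_open[OF has_derivative_const assms(1,2)]) (simp add: assms(3))
  then show ?thesis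
    using assms(4) has_derivative_unique by metis
qed

text \<open>On adding the \<open>e\<^sub>1\<close> derivative of the first equation to the
  \<open>e\<^sub>2\<close> derivative of the second, the time, viscous and second-order transport
  terms combine into derivatives of the divergence and cancel. What remains is quadratic in first
  derivatives.\<close>

lemma pressure_poisson_equation:
  fixes U\<^sub>1 U\<^sub>2 P :: "'a::real_normed_vector \<Rightarrow> real"
  assumes Q: "open Q" and sm: "smooth_on U\<^sub>1 Q" "smooth_on U\<^sub>2 Q" "smooth_on P Q"
    and momentum:
      "\<And>z. z \<in> Q \<Longrightarrow> dir_deriv \<tau> U\<^sub>1 z + (U\<^sub>1 z * dir_deriv e\<^sub>1 U\<^sub>1 z + U\<^sub>2 z * dir_deriv e\<^sub>2 U\<^sub>1 z)
        - (dir_deriv e\<^sub>1 (dir_deriv e\<^sub>1 U\<^sub>1) z + dir_deriv e\<^sub>2 (dir_deriv e\<^sub>2 U\<^sub>1) z) + dir_deriv e\<^sub>1 P z = 0"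
      "\<And>z. z \<in> Q \<Longrightarrow> dir_deriv \<tau> U\<^sub>2 z + (U\<^sub>1 z * dir_deriv e\<^sub>1 U\<^sub>2 z + U\<^sub>2 z * dir_deriv e\<^sub>2 U\<^sub>2 z)
        - (dir_deriv e\<^sub>1 (dir_deriv e\<^sub>1 U\<^sub>2) z + dir_deriv e\<^sub>2 (dir_deriv e\<^sub>2 U\<^sub>2) z) + dir_deriv e\<^sub>2 P z = 0"
    and div: "\<And>z. z \<in> Q \<Longrightarrow> dir_deriv e\<^sub>1 U\<^sub>1 z + dir_deriv e\<^sub>2 U\<^sub>2 z = 0"
    and z: "z \<in> Q"
  shows "dir_deriv e\<^sub>1 (dir_deriv e\<^sub>1 P) z + dir_deriv e\<^sub>2 (dir_deriv e\<^sub>2 P) z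
    = 2 * (dir_deriv e\<^sub>1 U\<^sub>1 z * dir_deriv e\<^sub>2 U\<^sub>2 z - dir_deriv e\<^sub>2 U\<^sub>1 z * dir_deriv e\<^sub>1 U\<^sub>2 z)"
proof -
  have d_momentum: "dir_deriv v (dir_deriv \<tau> U) z
      + ((U\<^sub>1 z * dir_deriv v (dir_deriv e\<^sub>1 U) z + dir_deriv v U\<^sub>1 z * dir_deriv e\<^sub>1 U z)
        + (U\<^sub>2 z * dir_deriv v (dir_deriv e\<^sub>2 U) z + dir_deriv v U\<^sub>2 z * dir_deriv e\<^sub>2 U z))
      - (dir_deriv v (dir_deriv e\<^sub>1 (dir_deriv e\<^sub>1 U)) z + dir_deriv v (dir_deriv e\<^sub>2 (dir_deriv e\<^sub>2 U)) z) + dir_deriv v (dir_deriv e P) z = 0"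
    if U: "smooth_on U Q" and eq: "\<And>z. z \<in> Q \<Longrightarrow> dir_deriv \<tau> U z + (U\<^sub>1 z * dir_deriv e\<^sub>1 U z + U\<^sub>2 z * dir_deriv e\<^sub>2 U z)
        - (dir_deriv e\<^sub>1 (dir_deriv e\<^sub>1 U) z + dir_deriv e\<^sub>2 (dir_deriv e\<^sub>2 U) z) + dir_deriv e P z = 0"
    for U e v
  proof -
    have "((\<lambda>z. dir_deriv \<tau> U z + (U\<^sub>1 z * dir_deriv e\<^sub>1 U z + U\<^sub>2 z * dir_deriv e\<^sub>2 U z)
        - (dir_deriv e\<^sub>1 (dir_deriv e\<^sub>1 U) z + dir_deriv e\<^sub>2 (dir_deriv e\<^sub>2 U) z) + dir_deriv e P z) has_derivative
      (\<lambda>v. dir_deriv v (dir_deriv \<tau> U) z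
        + ((U\<^sub>1 z * dir_deriv v (dir_deriv e\<^sub>1 U) z + dir_deriv v U\<^sub>1 z * dir_deriv e\<^sub>1 U z)
          + (U\<^sub>2 z * dir_deriv v (dir_deriv e\<^sub>2 U) z + dir_deriv v U\<^sub>2 z * dir_deriv e\<^sub>2 U z))
        - (dir_deriv v (dir_deriv e\<^sub>1 (dir_deriv e\<^sub>1 U)) z + dir_deriv v (dir_deriv e\<^sub>2 (dir_deriv e\<^sub>2 U)) z) + dir_deriv v (dir_deriv e P) z)) (at z)"
      by (intro has_derivative_add has_derivative_diff has_derivative_mult smooth_on_has_dir_deriv[OF _ z]
          smooth_on_dir_deriv sm U)
    from derivative_eq_0_on_open[OF Q z eq this] show ?thesis .
  qed
  have d_sum: "dir_deriv v f z + dir_deriv v g z = 0"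
    if "smooth_on f Q" "smooth_on g Q" "\<And>z. z \<in> Q \<Longrightarrow> f z + g z = 0" "z \<in> Q"
    for f g :: "'a \<Rightarrow> real" and v z
    using derivative_eq_0_on_open[OF Q that(4,3)
        has_derivative_add[OF smooth_on_has_dir_deriv[OF that(1,4)] smooth_on_has_dir_deriv[OF that(2,4)]]] .
  have d_div: "dir_deriv v (dir_deriv e\<^sub>1 U\<^sub>1) z + dir_deriv v (dir_deriv e\<^sub>2 U\<^sub>2) z = 0" if "z \<in> Q" for v z
    using d_sum[OF smooth_on_dir_deriv[OF sm(1)] smooth_on_dir_deriv[OF sm(2)] div that] .
  have dd_div: "dir_deriv v (dir_deriv v (dir_deriv e\<^sub>1 U\<^sub>1)) z + dir_deriv v (dir_deriv v (dir_deriv e\<^sub>2 U\<^sub>2)) z = 0" for v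
    using d_sum[OF smooth_on_dir_deriv[OF smooth_on_dir_deriv[OF sm(1)]] smooth_on_dir_deriv[OF smooth_on_dir_deriv[OF sm(2)]] d_div z] .
  have comm: "dir_deriv a (dir_deriv b w) z = dir_deriv b (dir_deriv a w) z" if "smooth_on w Q" for a b and w :: "'a \<Rightarrow> real"
    using dir_deriv_commute[OF Q that z] .
  \<comment> \<open>The inner exchange holds on all of \<open>Q\<close>, not just at
    \<open>z\<close>, so it may be differentiated once more.\<close>
  have comm3: "dir_deriv a (dir_deriv b (dir_deriv b w)) z = dir_deriv b (dir_deriv b (dir_deriv a w)) z" if "smooth_on w Q" for a b and w :: "'a \<Rightarrow> real"
  proof -
    have "dir_deriv b (dir_deriv a (dir_deriv b w)) z = dir_deriv b (dir_deriv b (dir_deriv a w)) z"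
      by (rule dir_deriv_cong[OF Q z smooth_on_dir_deriv[OF smooth_on_dir_deriv[OF that]] dir_deriv_commute[OF Q that]])
    with comm[OF smooth_on_dir_deriv[OF that]] show ?thesis by simp
  qed
  define a b c where "a = dir_deriv e\<^sub>1 U\<^sub>1 z" and "b = dir_deriv e\<^sub>1 U\<^sub>2 z" and "c = dir_deriv e\<^sub>2 U\<^sub>1 z"
  have d: "dir_deriv e\<^sub>2 U\<^sub>2 z = - a"
    using div[OF z] by (simp add: a_def)
  have t: "dir_deriv e\<^sub>1 (dir_deriv \<tau> U\<^sub>1) z + dir_deriv e\<^sub>2 (dir_deriv \<tau> U\<^sub>2) z = 0"
    using d_div[OF z, of \<tau>] comm[OF sm(1), of e\<^sub>1 \<tau>] comm[OF sm(2), of e\<^sub>2 \<tau>] by simp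
  \<comment> \<open>The coefficient is multiplied in so that the products match those in
    \<open>d_momentum\<close> and the final step is linear in them.\<close>
  have n: "U * dir_deriv e\<^sub>1 (dir_deriv v U\<^sub>1) z + U * dir_deriv e\<^sub>2 (dir_deriv v U\<^sub>2) z = 0" for U v
    using d_div[OF z, of v] comm[OF sm(1), of e\<^sub>1 v] comm[OF sm(2), of e\<^sub>2 v]
    by (simp flip: distrib_left)
  have l: "dir_deriv e\<^sub>1 (dir_deriv v (dir_deriv v U\<^sub>1)) z + dir_deriv e\<^sub>2 (dir_deriv v (dir_deriv v U\<^sub>2)) z = 0" for v
    using dd_div[of v] comm3[OF sm(1), of e\<^sub>1 v] comm3[OF sm(2), of e\<^sub>2 v] by simp
  have "dir_deriv e\<^sub>1 (dir_deriv e\<^sub>1 P) z + dir_deriv e\<^sub>2 (dir_deriv e\<^sub>2 P) z = - (a * a + b * c + c * b + a * a)"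
    using d_momentum[OF sm(1) momentum(1), of e\<^sub>1] d_momentum[OF sm(2) momentum(2), of e\<^sub>2]
      t n[of "U\<^sub>1 z" e\<^sub>1] n[of "U\<^sub>2 z" e\<^sub>2] l[of e\<^sub>1] l[of e\<^sub>2]
    unfolding d a_def[symmetric] b_def[symmetric] c_def[symmetric] minus_mult_minus by linarith
  then show ?thesis
    unfolding d a_def[symmetric] b_def[symmetric] c_def[symmetric] by (simp add: algebra_simps)
qed

section \<open>Passage from operators on time slices to directional derivatives in
  space-time\<close>

lemma partial_deriv_time_slice:
  fixes w :: "(real^'n::finite) \<times> real \<Rightarrow> 'b::real_normed_vector"
  assumes w: "smooth_on w (\<Omega> \<times> T)" and "x \<in> \<Omega>" "t \<in> T"
  shows "partial_deriv i (\<lambda>y. w (y, t)) x = dir_deriv (axis i 1, 0) w (x, t)"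
  unfolding partial_deriv_def
proof (rule frechet_derivative_eqI)
  show "((\<lambda>y. w (y, t)) has_derivative (\<lambda>h. dir_deriv (h, 0) w (x, t))) (at x)"
    by (rule has_derivative_compose[where f = "\<lambda>y. (y, t)" and f' = "\<lambda>h. (h, 0)"])
      (use assms in \<open>auto intro!: smooth_on_has_dir_deriv[OF w] derivative_eq_intros\<close>)
qed

lemma laplacian_time_slice:
  fixes w :: "(real^'n::finite) \<times> real \<Rightarrow> 'b::real_normed_vector"
  assumes "open \<Omega>" and w: "smooth_on w (\<Omega> \<times> T)" and "x \<in> \<Omega>" "t \<in> T"
  shows "laplacian (\<lambda>y. w (y, t)) x
    = (\<Sum>i\<in>UNIV. dir_deriv (axis i 1, 0) (dir_deriv (axis i 1, 0) w) (x, t))"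
  unfolding laplacian_def
proof (rule sum.cong[OF refl])
  fix i :: 'n
  let ?g = "\<lambda>y. dir_deriv (axis i 1, 0) w (y, t)"
  have "?g differentiable (at x)"
  proof -
    have "(?g has_derivative (\<lambda>h. dir_deriv (h, 0) (dir_deriv (axis i 1, 0) w) (x, t))) (at x)"
      by (rule has_derivative_compose[where f = "\<lambda>y. (y, t)" and f' = "\<lambda>h. (h, 0)"])
        (use assms in \<open>auto intro!: smooth_on_has_dir_deriv[OF smooth_on_dir_deriv[OF w]] derivative_eq_intros\<close>)
    then show ?thesis by (auto simp: differentiable_def)
  qed
  then have "partial_deriv i (partial_deriv i (\<lambda>y. w (y, t))) x = partial_deriv i ?g x"
    unfolding partial_deriv_def[of i "partial_deriv i (\<lambda>y. w (y, t))"] partial_deriv_def[of i ?g]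
    using frechet_derivative_transform_within_open[of ?g x \<Omega> "partial_deriv i (\<lambda>y. w (y, t))"]
      assms partial_deriv_time_slice[OF w] by simp
  then show "partial_deriv i (partial_deriv i (\<lambda>y. w (y, t))) x
      = dir_deriv (axis i 1, 0) (dir_deriv (axis i 1, 0) w) (x, t)"
    using partial_deriv_time_slice[OF smooth_on_dir_deriv[OF w] assms(3,4)] by simp
qed

lemma dir_deriv_vec_nth:
  fixes w :: "'a::real_normed_vector \<Rightarrow> real^'n::finite"
  assumes "smooth_on w Q" "z \<in> Q"
  shows "dir_deriv v (\<lambda>z. w z $ i) z = dir_deriv v w z $ i"
  unfolding dir_deriv_def[of v "\<lambda>z. w z $ i"]
  using bounded_linear.has_derivative[OF bounded_linear_vec_nth smooth_on_has_dir_deriv[OF assms]]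
  by (rule frechet_derivative_eqI)

lemma laplacian_pressure_eq:
  assumes "open \<Omega>" and ns: "smooth_navier_stokes_solution \<Omega> u p" and x: "x \<in> \<Omega>" and t: "t > 0"
  shows "laplacian (\<lambda>y. p y t) x
    = 2 * cross2 (gradient (\<lambda>y. u y t $ 1) x) (gradient (\<lambda>y. u y t $ 2) x)"
proof -
  define Q :: "((real^2) \<times> real) set" where "Q = \<Omega> \<times> {0<..}"
  define V where "V = (\<lambda>(x, t). u x t)"
  define P where "P = (\<lambda>(x, t). p x t)"
  define U where "U i = (\<lambda>z. V z $ i)" for i
  define e :: "2 \<Rightarrow> (real^2) \<times> real" where "e i = (axis i 1, 0)" for i
  define \<tau> :: "(real^2) \<times> real" where "\<tau> = (0, 1)"
  have Q: "open Q"
    unfolding Q_def using \<open>open \<Omega>\<close> by (intro open_Times) auto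
  have V: "smooth_on V Q" and P: "smooth_on P Q"
    using ns by (simp_all add: smooth_navier_stokes_solution_def V_def P_def Q_def)
  have U: "smooth_on (U i) Q" for i
    unfolding smooth_on_def U_def
    using Ck_on_bounded_linear[OF Q bounded_linear_vec_nth smooth_on_D[OF V]] by blast
  have nth1: "dir_deriv v V z $ i = dir_deriv v (U i) z" if "z \<in> Q" for v z i
    using dir_deriv_vec_nth[OF V that] by (simp add: U_def)
  have nth2: "dir_deriv v (dir_deriv v V) z $ i = dir_deriv v (dir_deriv v (U i)) z" if "z \<in> Q" for v z i
  proof -
    have "dir_deriv v (dir_deriv v V) z $ i = dir_deriv v (\<lambda>z. dir_deriv v V z $ i) z"
      using dir_deriv_vec_nth[OF smooth_on_dir_deriv[OF V] that] by simp
    also have "\<dots> = dir_deriv v (dir_deriv v (U i)) z"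
      using nth1 by (intro dir_deriv_cong[OF Q that smooth_on_dir_deriv[OF U], symmetric]) auto
    finally show ?thesis .
  qed
  have pd: "partial_deriv i (\<lambda>y. w (y, s)) y = dir_deriv (e i) w (y, s)"
    if "smooth_on w Q" "y \<in> \<Omega>" "s > 0" for i y s and w :: "(real^2) \<times> real \<Rightarrow> 'b::real_normed_vector"
    using partial_deriv_time_slice[of w \<Omega> "{0<..}"] that by (simp add: Q_def e_def)
  have momentum: "dir_deriv \<tau> (U i) z + (U 1 z * dir_deriv (e 1) (U i) z + U 2 z * dir_deriv (e 2) (U i) z)
        - (dir_deriv (e 1) (dir_deriv (e 1) (U i)) z + dir_deriv (e 2) (dir_deriv (e 2) (U i)) z) + dir_deriv (e i) P z = 0"
    and div: "dir_deriv (e 1) (U 1) z + dir_deriv (e 2) (U 2) z = 0"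
    if z: "z \<in> Q" for z i
  proof -
    obtain y s where ys: "z = (y, s)" "y \<in> \<Omega>" "s > 0"
      using z by (auto simp: Q_def)
    have eq: "vector_derivative (\<lambda>s. u y s) (at s) + advection (\<lambda>y. u y s) (\<lambda>y. u y s) y
          - laplacian (\<lambda>y. u y s) y + gradient (\<lambda>y. p y s) y = 0"
      and "divergence (\<lambda>y. u y s) y = 0"
      using ns ys by (auto simp: smooth_navier_stokes_solution_def)
    have "((\<lambda>s. V (y, s)) has_derivative (\<lambda>h. dir_deriv (0, h) V z)) (at s)"
      by (rule has_derivative_compose[where f = "\<lambda>s. (y, s)" and f' = "\<lambda>h. (0, h)"])
        (use z ys smooth_on_has_dir_deriv[OF V] in \<open>auto intro!: derivative_eq_intros\<close>)
    \<comment> \<open>Homogeneity in the direction turns the derivative along the time axis into a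
      vector derivative.\<close>
    moreover have "dir_deriv (0, h) V z = h *\<^sub>R dir_deriv \<tau> V z" for h
    proof -
      have "linear (\<lambda>v. dir_deriv v V z)"
        using smooth_on_has_dir_deriv[OF V z] has_derivative_linear by blast
      from linear_cmul[OF this, of h \<tau>] show ?thesis by (simp add: \<tau>_def)
    qed
    ultimately have "((\<lambda>s. u y s) has_vector_derivative dir_deriv \<tau> V z) (at s)"
      by (simp add: has_vector_derivative_def V_def)
    then have 1: "vector_derivative (\<lambda>s. u y s) (at s) $ i = dir_deriv \<tau> (U i) z"
      using nth1[OF z] by (simp add: vector_derivative_at)
    have V_slice: "(\<lambda>y. u y s) = (\<lambda>y. V (y, s))" and P_slice: "(\<lambda>y. p y s) = (\<lambda>y. P (y, s))"
      and U_slice: "\<And>i. (\<lambda>y. u y s $ i) = (\<lambda>y. U i (y, s))"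
      by (simp_all add: V_def P_def U_def)
    have 2: "advection (\<lambda>y. u y s) (\<lambda>y. u y s) y $ i
        = U 1 z * dir_deriv (e 1) (U i) z + U 2 z * dir_deriv (e 2) (U i) z"
      unfolding advection_def V_slice
      using pd[OF V ys(2,3)] nth1[OF z] ys(1) by (simp add: sum_2 U_def)
    have 3: "laplacian (\<lambda>y. u y s) y $ i = dir_deriv (e 1) (dir_deriv (e 1) (U i)) z + dir_deriv (e 2) (dir_deriv (e 2) (U i)) z"
      unfolding V_slice using laplacian_time_slice[of \<Omega> V "{0<..}" y s] V ys \<open>open \<Omega>\<close> nth2[OF z]
      by (simp add: sum_2 Q_def e_def)
    have 4: "gradient (\<lambda>y. p y s) y $ i = dir_deriv (e i) P z"
      unfolding P_slice gradient_def using pd[OF P ys(2,3)] ys(1) by simp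
    from arg_cong[OF eq, of "\<lambda>v. v $ i"] show "dir_deriv \<tau> (U i) z
        + (U 1 z * dir_deriv (e 1) (U i) z + U 2 z * dir_deriv (e 2) (U i) z)
        - (dir_deriv (e 1) (dir_deriv (e 1) (U i)) z + dir_deriv (e 2) (dir_deriv (e 2) (U i)) z) + dir_deriv (e i) P z = 0"
      by (simp add: 1 2 3 4)
    show "dir_deriv (e 1) (U 1) z + dir_deriv (e 2) (U 2) z = 0"
      using \<open>divergence (\<lambda>y. u y s) y = 0\<close> pd[OF U ys(2,3)] ys(1)
      unfolding divergence_def U_slice by (simp add: sum_2)
  qed
  have z: "(x, t) \<in> Q" using x t by (simp add: Q_def)
  have "laplacian (\<lambda>y. p y t) x = dir_deriv (e 1) (dir_deriv (e 1) P) (x, t) + dir_deriv (e 2) (dir_deriv (e 2) P) (x, t)"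
    using laplacian_time_slice[of \<Omega> P "{0<..}" x t] P x t \<open>open \<Omega>\<close>
    by (simp add: sum_2 Q_def e_def P_def)
  also have "\<dots> = 2 * (dir_deriv (e 1) (U 1) (x, t) * dir_deriv (e 2) (U 2) (x, t)
      - dir_deriv (e 2) (U 1) (x, t) * dir_deriv (e 1) (U 2) (x, t))"
    by (rule pressure_poisson_equation[OF Q U U P momentum momentum div z])
  also have "\<dots> = 2 * cross2 (gradient (\<lambda>y. u y t $ 1) x) (gradient (\<lambda>y. u y t $ 2) x)"
  proof -
    have "(\<lambda>y. u y t $ i) = (\<lambda>y. U i (y, t))" for i
      by (simp add: V_def U_def)
    then show ?thesis
      by (simp add: cross2_def gradient_def pd[OF U x t])
  qed
  finally show ?thesis .
qed


section \<open>Vanishing of the Laplacian of the pressure\<close>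

text \<open>The set where \<open>g\<close> is nonzero is open by continuity and null by the
  integral, hence empty.\<close>

lemma continuous_nonneg_integral_eq_0:
  fixes g :: "'a::euclidean_space \<Rightarrow> real"
  assumes "open \<Omega>" and cont: "continuous_on \<Omega> g" and "integrable (lebesgue_on \<Omega>) g"
    and "(LINT x|lebesgue_on \<Omega>. g x) = 0" and nonneg: "\<And>x. x \<in> \<Omega> \<Longrightarrow> g x \<ge> 0" and "x \<in> \<Omega>"
  shows "g x = 0"
proof -
  have "AE x in lebesgue_on \<Omega>. g x = 0"
    using assms by (subst integral_nonneg_eq_0_iff_AE[symmetric]) (auto intro!: AE_I2 simp: space_restrict_space)
  then have "AE x in lebesgue. x \<in> \<Omega> \<longrightarrow> g x = 0"
    using \<open>open \<Omega>\<close> by (subst (asm) AE_restrict_space_iff) auto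
  then have "negligible {x. \<not> (x \<in> \<Omega> \<longrightarrow> g x = 0)}"
    unfolding eventually_ae_filter_negligible by (blast intro: negligible_subset)
  moreover have "open (g -` (- {0}) \<inter> \<Omega>)"
    using cont \<open>open \<Omega>\<close> by (auto simp: continuous_on_open_vimage)
  moreover have "{x. \<not> (x \<in> \<Omega> \<longrightarrow> g x = 0)} = g -` (- {0}) \<inter> \<Omega>"
    by auto
  ultimately show ?thesis
    using open_not_negligible \<open>x \<in> \<Omega>\<close> by fastforce
qed

theorem mainTheorem5:
  fixes \<Omega> :: "(real^2) set"
    and u :: "real^2 \<Rightarrow> real \<Rightarrow> real^2"
    and p :: "real^2 \<Rightarrow> real \<Rightarrow> real"
  assumes "is_domain \<Omega>" and "bounded \<Omega>" and "C1_boundary \<Omega>"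
    and "smooth_navier_stokes_solution \<Omega> u p"
    and "\<forall>t>0. \<forall>i. (\<lambda>x. u x t $ i) \<in> H10 \<Omega>"
  shows "(\<forall>t>0. (\<forall>x\<in>\<Omega>. laplacian (\<lambda>y. p y t) x \<le> 0) \<longrightarrow>
                (\<forall>x\<in>\<Omega>. laplacian (\<lambda>y. p y t) x = 0)) \<and>
         (\<forall>t>0. \<exists>z\<in>\<Omega>. laplacian (\<lambda>y. p y t) z = 0)"
proof -
  have "open \<Omega>" "connected \<Omega>" "\<Omega> \<noteq> {}"
    using assms(1) by (auto simp: is_domain_def)
  \<comment> \<open>The factor \<open>s\<close> in \<open>vanish\<close> treats both signs at once:
    \<open>-1\<close> for a nonpositive Laplacian, \<open>1\<close> for a nonnegative one.\<close>
  have L_cont: "continuous_on \<Omega> (laplacian (\<lambda>y. p y t))"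
    and vanish: "\<And>s x. s \<noteq> 0 \<Longrightarrow> (\<And>x. x \<in> \<Omega> \<Longrightarrow> s * laplacian (\<lambda>y. p y t) x \<ge> 0) \<Longrightarrow>
      x \<in> \<Omega> \<Longrightarrow> laplacian (\<lambda>y. p y t) x = 0"
    if t: "t > 0" for t
  proof -
    let ?L = "laplacian (\<lambda>y. p y t)"
    let ?f = "\<lambda>i x. u x t $ i"
    let ?J = "\<lambda>x. cross2 (gradient (?f 1) x) (gradient (?f 2) x)"
    have C1: "Ck_on (Suc 0) (?f i) \<Omega>" for i
    proof -
      have Q: "open (\<Omega> \<times> {0::real<..})"
        using \<open>open \<Omega>\<close> by (intro open_Times) auto
      have "Ck_on (Suc 0) (\<lambda>(x, t). u x t) (\<Omega> \<times> {0<..})"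
        using assms(4) by (simp add: smooth_navier_stokes_solution_def smooth_on_def)
      \<comment> \<open>The time slice is the composition with the affine embedding of y as (y, 0) +
        (0, t).\<close>
      from Ck_on_compose_affine[OF Q \<open>open \<Omega>\<close> _ _ this, of "\<lambda>y. (y, 0)" "(0, t)"]
      have "Ck_on (Suc 0) (\<lambda>x. u x t) \<Omega>"
        using t bounded_linear_Pair[OF bounded_linear_ident bounded_linear_zero] by simp
      then show ?thesis
        by (rule Ck_on_bounded_linear[OF \<open>open \<Omega>\<close> bounded_linear_vec_nth])
    qed
    have L: "?L x = 2 * ?J x" if "x \<in> \<Omega>" for x
      using laplacian_pressure_eq[OF \<open>open \<Omega>\<close> assms(4) that t] .
    have "continuous_on \<Omega> (\<lambda>x. 2 * ?J x)"
      unfolding cross2_def gradient_def vec_lambda_beta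
      by (intro continuous_on_mult continuous_on_diff continuous_on_const Ck_on_1_continuous_on_partial_deriv C1)
    then show cont: "continuous_on \<Omega> ?L"
      by (rule continuous_on_cong[THEN iffD1, rotated -1]) (auto simp: L)
    have H: "?f 1 \<in> H1 \<Omega>" "?f 2 \<in> H10 \<Omega>"
      using assms(5) t by (auto simp: H10_def)
    note J = integral_cross2_gradient_H10_eq_0[OF \<open>open \<Omega>\<close> C1 C1 H]
    have int_L: "integrable (lebesgue_on \<Omega>) ?L" "(LINT x|lebesgue_on \<Omega>. ?L x) = 0"
    proof -
      have "integrable (lebesgue_on \<Omega>) ?L \<longleftrightarrow> integrable (lebesgue_on \<Omega>) (\<lambda>x. 2 * ?J x)"
        by (intro Bochner_Integration.integrable_cong) (auto simp: L space_restrict_space)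
      then show "integrable (lebesgue_on \<Omega>) ?L" using J(1) by simp
      have "(LINT x|lebesgue_on \<Omega>. ?L x) = (LINT x|lebesgue_on \<Omega>. 2 * ?J x)"
        by (intro Bochner_Integration.integral_cong) (auto simp: L space_restrict_space)
      then show "(LINT x|lebesgue_on \<Omega>. ?L x) = 0" using J(2) by simp
    qed
    show "?L x = 0" if s: "s \<noteq> 0" and nonneg: "\<And>x. x \<in> \<Omega> \<Longrightarrow> s * ?L x \<ge> 0" and "x \<in> \<Omega>" for s x
    proof -
      have "s * ?L x = 0"
      proof (rule continuous_nonneg_integral_eq_0[OF \<open>open \<Omega>\<close> _ _ _ nonneg \<open>x \<in> \<Omega>\<close>])
        show "continuous_on \<Omega> (\<lambda>x. s * ?L x)"
          by (intro continuous_on_mult continuous_on_const cont)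
      qed (use int_L in auto)
      then show ?thesis using s by simp
    qed
  qed
  have "\<exists>z\<in>\<Omega>. laplacian (\<lambda>y. p y t) z = 0" if t: "t > 0" for t
  proof (rule ccontr)
    let ?L = "laplacian (\<lambda>y. p y t)"
    assume no_zero: "\<not> (\<exists>z\<in>\<Omega>. ?L z = 0)"
    \<comment> \<open>Without zeros, the intermediate value property fixes the sign of the
      Laplacian; \<open>vanish\<close> then makes it zero, a contradiction.\<close>
    have "connected (?L ` \<Omega>)"
      using L_cont[OF t] \<open>connected \<Omega>\<close> by (rule connected_continuous_image)
    then have "{?L x..?L y} \<subseteq> ?L ` \<Omega>" if "x \<in> \<Omega>" "y \<in> \<Omega>" for x y
      using that by (intro connected_contains_Icc) auto
    with no_zero have no_change: "\<not> (?L x \<le> 0 \<and> 0 \<le> ?L y)" if "x \<in> \<Omega>" "y \<in> \<Omega>" for x y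
      using that by fastforce
    obtain x where x: "x \<in> \<Omega>" using \<open>\<Omega> \<noteq> {}\<close> by blast
    have "\<exists>s\<noteq>0. \<forall>y\<in>\<Omega>. s * ?L y \<ge> 0"
    proof (cases "?L x \<le> 0")
      case True
      then show ?thesis
        using no_change[OF x] by (intro exI[of _ "-1"]) (auto simp: not_le less_imp_le)
    next
      case False
      then show ?thesis
        using no_change[OF _ x] by (intro exI[of _ 1]) (auto simp: not_le less_imp_le)
    qed
    then have "?L x = 0"
      using vanish[OF t _ _ x] by blast
    with no_zero x show False by blast
  qed
  moreover have "laplacian (\<lambda>y. p y t) x = 0"
    if "t > 0" "\<forall>x\<in>\<Omega>. laplacian (\<lambda>y. p y t) x \<le> 0" "x \<in> \<Omega>" for t x
    using vanish[OF that(1), of "-1"] that(2,3) by auto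
  ultimately show ?thesis by blast
qed

end
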